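(* Let $r\ge2$ and let $M$ be the monoid with presentation $\langle x_1,\ldots,x_r\mid x_ix_1=x_1^2\text{ for all }i=2,\ldots,r\rangle$. Then $M$ is homogeneously finitely generated, left cancellative, and every pair of elements of $M$ has a least (with respect to $\le_L$) common right multiple; consequently $\mathcal{L}:=(M,\le_L)$ is an upho lattice. Its core is the lattice $M_r$, and $F(\mathcal{L};x)^{-1}=\chi^*(M_r;x)=1-rx+(r-1)x^2$.
   Context: A monoid is homogeneously finitely generated if it has a presentation with finitely many generators in which every relation $w=w'$ has $w,w'$ words of equal length. Left cancellative: $ab=ac$ implies $b=c$. Left divisibility: $a\le_L b$ iff $ax=b$ for some $x\in M$; $b$ is then a right multiple of $a$. $M_r$ denotes the unique finite graded lattice of rank two with exactly $r$ atoms. A poset $\mathcal{P}$ is finite type $\mathbb{N}$-graded if it has a minimum $\hat0$, a rank function $\rho:\mathcal{P}\to\mathbb{N}$ with $\rho(\hat0)=0$ such that every maximal chain has the form $\hat0=x_0\lessdot x_1\lessdot\cdots$ with $\rho(x_i)=i$, and finitely many elements of each rank. An upho lattice is a finite type $\mathbb{N}$-graded lattice $\mathcal{L}$ with at least two elements such that for every $p\in\mathcal{L}$ the principal filter $\{q\ge p\}$ is isomorphic to $\mathcal{L}$. Its core is $[\hat0,s_1\vee\cdots\vee s_r]$ with $s_i$ the atoms. The rank generating function is $F(\mathcal{L};x)=\sum_{p\in\mathcal{L}}x^{\rho(p)}$, and for a finite graded lattice $L$, $\chi^*(L;x)=\sum_{p\in L}\mu(\hat0,p)x^{\rho(p)}$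 with $\mu$ the Möbius function. *)

theory Defs
  imports
    "HOL-Algebra.Divisibility"
    "HOL-Library.Extended_Nat"
    "HOL-Computational_Algebra.Polynomial_FPS"
begin

section \<open>Monoids given by presentations\<close>

text \<open>The least congruence containing \<open>R\<close> on the free monoid of words over \<open>X\<close>, where \<open>R\<close> is
  understood to be a relation on \<open>lists X\<close>.\<close>

inductive_set pres_cong :: "'a set \<Rightarrow> ('a list \<times> 'a list) set \<Rightarrow> ('a list \<times> 'a list) set"
  for X R where
  rel: "(u, v) \<in> R \<Longrightarrow> u \<in> lists X \<Longrightarrow> v \<in> lists X \<Longrightarrow> (u, v) \<in> pres_cong X R"
| refl: "u \<in> lists X \<Longrightarrow> (u, u) \<in> pres_cong X R"
| sym: "(u, v) \<in> pres_cong X R \<Longrightarrow> (v, u) \<in> pres_cong X R"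
| trans: "(u, v) \<in> pres_cong X R \<Longrightarrow> (v, w) \<in> pres_cong X R \<Longrightarrow> (u, w) \<in> pres_cong X R"
| append: "(u, v) \<in> pres_cong X R \<Longrightarrow> (u', v') \<in> pres_cong X R \<Longrightarrow> (u @ u', v @ v') \<in> pres_cong X R"

definition presented_monoid :: "'a set \<Rightarrow> ('a list \<times> 'a list) set \<Rightarrow> 'a list set monoid" where
  "presented_monoid X R =
     \<lparr>carrier = lists X // pres_cong X R,
      mult = (\<lambda>A B. \<Union>u\<in>A. \<Union>v\<in>B. pres_cong X R `` {u @ v}),
      one = pres_cong X R `` {[]}\<rparr>"

lemma pres_cong_lists: "(u, v) \<in> pres_cong X R \<Longrightarrow> u \<in> lists X \<and> v \<in> lists X"
  by (induction rule: pres_cong.induct) auto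

lemma equiv_pres_cong: "equiv (lists X) (pres_cong X R)"
  by (intro equivI refl_onI symI transI subsetI)
     (auto dest: pres_cong_lists intro: pres_cong.intros(2-4))

lemma pres_cong_class_mult:
  assumes "u \<in> lists X" "v \<in> lists X"
  shows "pres_cong X R `` {u} \<otimes>\<^bsub>presented_monoid X R\<^esub> pres_cong X R `` {v} = pres_cong X R `` {u @ v}"
proof -
  have "pres_cong X R `` {u' @ v'} = pres_cong X R `` {u @ v}"
    if "u' \<in> pres_cong X R `` {u}" "v' \<in> pres_cong X R `` {v}" for u' v'
    using that by (intro equiv_class_eq[OF equiv_pres_cong] pres_cong.sym[OF pres_cong.append]) auto
  then have "(\<Union>u'\<in>pres_cong X R `` {u}. \<Union>v'\<in>pres_cong X R `` {v}. pres_cong X R `` {u' @ v'})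
      = (\<Union>u'\<in>pres_cong X R `` {u}. \<Union>v'\<in>pres_cong X R `` {v}. pres_cong X R `` {u @ v})"
    by (intro SUP_cong) simp_all
  also have "\<dots> = pres_cong X R `` {u @ v}"
  proof -
    have "u \<in> pres_cong X R `` {u}" "v \<in> pres_cong X R `` {v}"
      using assms by (simp_all add: pres_cong.refl)
    then have "pres_cong X R `` {u} \<noteq> {}" "pres_cong X R `` {v} \<noteq> {}" by blast+
    then show ?thesis by simp
  qed
  finally show ?thesis by (simp add: presented_monoid_def)
qed

lemma monoid_presented_monoid: "monoid (presented_monoid X R)"
proof -
  have car: "\<exists>u\<in>lists X. a = pres_cong X R `` {u}" if "a \<in> carrier (presented_monoid X R)" for a
    using that by (auto simp: presented_monoid_def elim!: quotientE)
  have car': "pres_cong X R `` {u} \<in> carrier (presented_monoid X R)" if "u \<in> lists X" for u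
    using that by (auto simp: presented_monoid_def intro!: quotientI)
  have one: "\<one>\<^bsub>presented_monoid X R\<^esub> = pres_cong X R `` {[]}"
    by (simp add: presented_monoid_def)
  show ?thesis
  proof (rule monoidI)
    fix x y z
    assume x: "x \<in> carrier (presented_monoid X R)" and y: "y \<in> carrier (presented_monoid X R)"
    obtain u v where u: "u \<in> lists X" "x = pres_cong X R `` {u}"
      and v: "v \<in> lists X" "y = pres_cong X R `` {v}"
      using car[OF x] car[OF y] by blast
    have uv: "u @ v \<in> lists X" using u v by auto
    show "x \<otimes>\<^bsub>presented_monoid X R\<^esub> y \<in> carrier (presented_monoid X R)"
      unfolding u(2) v(2) pres_cong_class_mult[OF u(1) v(1)] by (rule car'[OF uv])
    assume z: "z \<in> carrier (presented_monoid X R)"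
    obtain w where w: "w \<in> lists X" "z = pres_cong X R `` {w}"
      using car[OF z] by blast
    have vw: "v @ w \<in> lists X" using v w by auto
    show "x \<otimes>\<^bsub>presented_monoid X R\<^esub> y \<otimes>\<^bsub>presented_monoid X R\<^esub> z
        = x \<otimes>\<^bsub>presented_monoid X R\<^esub> (y \<otimes>\<^bsub>presented_monoid X R\<^esub> z)"
      unfolding u(2) v(2) w(2) pres_cong_class_mult[OF u(1) v(1)] pres_cong_class_mult[OF v(1) w(1)]
        pres_cong_class_mult[OF uv w(1)] pres_cong_class_mult[OF u(1) vw] by simp
  next
    show "\<one>\<^bsub>presented_monoid X R\<^esub> \<in> carrier (presented_monoid X R)"
      unfolding one by (rule car') simp
  next
    fix x assume "x \<in> carrier (presented_monoid X R)"
    then obtain u where u: "u \<in> lists X" "x = pres_cong X R `` {u}"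
      using car by blast
    show "\<one>\<^bsub>presented_monoid X R\<^esub> \<otimes>\<^bsub>presented_monoid X R\<^esub> x = x"
      unfolding one u(2) by (subst pres_cong_class_mult) (use u in auto)
    show "x \<otimes>\<^bsub>presented_monoid X R\<^esub> \<one>\<^bsub>presented_monoid X R\<^esub> = x"
      unfolding one u(2) by (subst pres_cong_class_mult) (use u in auto)
  qed
qed

text \<open>A finite generating set may be taken to consist of natural numbers, which avoids quantifying
  over a type of generators.\<close>

definition homogeneously_finitely_generated :: "('a, 'b) monoid_scheme \<Rightarrow> bool" where
  "homogeneously_finitely_generated M \<longleftrightarrow> monoid M \<and>
     (\<exists>(X :: nat set) R. finite X \<and> R \<subseteq> lists X \<times> lists X \<and>
        (\<forall>(w, w')\<in>R. length w = length w') \<and> M \<cong> presented_monoid X R)"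

definition left_cancellative :: "('a, 'b) monoid_scheme \<Rightarrow> bool" where
  "left_cancellative M \<longleftrightarrow>
     (\<forall>a\<in>carrier M. \<forall>b\<in>carrier M. \<forall>c\<in>carrier M. a \<otimes>\<^bsub>M\<^esub> b = a \<otimes>\<^bsub>M\<^esub> c \<longrightarrow> b = c)"

text \<open>In a noncommutative monoid \<^const>\<open>factor\<close> is left divisibility (the cofactor stands on the
  right), and \<^const>\<open>islcm\<close> accordingly describes least common right multiples. The library's
  \<^abbrev>\<open>division_rel\<close> is not used because its \<open>eq\<close> identifies mutually dividing elements.\<close>

definition left_div_order :: "('a, 'b) monoid_scheme \<Rightarrow> 'a gorder" where
  "left_div_order M = \<lparr>carrier = carrier M, eq = (=), le = factor M\<rparr>"


section \<open>Graded posets and upho lattices\<close>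

definition covered_by :: "'a gorder \<Rightarrow> 'a \<Rightarrow> 'a \<Rightarrow> bool" where
  "covered_by P x y \<longleftrightarrow> x \<in> carrier P \<and> y \<in> carrier P \<and> x \<sqsubset>\<^bsub>P\<^esub> y \<and>
     \<not> (\<exists>z\<in>carrier P. x \<sqsubset>\<^bsub>P\<^esub> z \<and> z \<sqsubset>\<^bsub>P\<^esub> y)"

text \<open>For \<open>N = \<infinity>\<close> every maximal chain is an infinite chain
  \<open>x 0 \<lessdot> x 1 \<lessdot> \<dots>\<close>, for \<open>N = enat n\<close> it is \<open>x 0 \<lessdot> \<dots> \<lessdot> x n\<close>. As every element
  lies on a maximal chain, the values of \<open>\<rho>\<close> on the carrier are determined by \<open>P\<close>.\<close>

definition rank_function :: "'a gorder \<Rightarrow> enat \<Rightarrow> ('a \<Rightarrow> nat) \<Rightarrow> bool" where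
  "rank_function P N \<rho> \<longleftrightarrow>
     (\<forall>C. pred_on.maxchain (carrier P) (\<sqsubset>\<^bsub>P\<^esub>) C \<longrightarrow>
        (\<exists>x :: nat \<Rightarrow> 'a. C = x ` {i. enat i \<le> N} \<and> least P (x 0) (carrier P) \<and>
           (\<forall>i. enat (Suc i) \<le> N \<longrightarrow> covered_by P (x i) (x (Suc i))) \<and>
           (\<forall>i. enat i \<le> N \<longrightarrow> \<rho> (x i) = i)))"

definition rank :: "'a gorder \<Rightarrow> 'a \<Rightarrow> nat" where
  "rank P = (SOME \<rho>. \<exists>N. rank_function P N \<rho>)"

definition finite_type_N_graded :: "'a gorder \<Rightarrow> bool" where
  "finite_type_N_graded P \<longleftrightarrow> partial_order P \<and> (\<exists>b. least P b (carrier P)) \<and>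
     (\<exists>\<rho>. rank_function P \<infinity> \<rho> \<and> (\<forall>k. finite {p \<in> carrier P. \<rho> p = k}))"

definition finite_graded_lattice :: "'a gorder \<Rightarrow> nat \<Rightarrow> bool" where
  "finite_graded_lattice L n \<longleftrightarrow> lattice L \<and> finite (carrier L) \<and>
     (\<exists>\<rho>. rank_function L (enat n) \<rho>)"

definition order_isomorphic :: "'a gorder \<Rightarrow> 'b gorder \<Rightarrow> bool" where
  "order_isomorphic P Q \<longleftrightarrow> (\<exists>f. order_emb P Q f \<and> bij_betw f (carrier P) (carrier Q))"

definition upho_lattice :: "'a gorder \<Rightarrow> bool" where
  "upho_lattice L \<longleftrightarrow> lattice L \<and> finite_type_N_graded L \<and>
     (\<exists>p\<in>carrier L. \<exists>q\<in>carrier L. p \<noteq> q) \<and>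
     (\<forall>p\<in>carrier L. order_isomorphic (L\<lparr>carrier := {q \<in> carrier L. p \<sqsubseteq>\<^bsub>L\<^esub> q}\<rparr>) L)"

definition atoms :: "'a gorder \<Rightarrow> 'a set" where
  "atoms L = {s. covered_by L \<bottom>\<^bsub>L\<^esub> s}"

definition core :: "'a gorder \<Rightarrow> 'a gorder" where
  "core L = L\<lparr>carrier := \<lbrace>\<bottom>\<^bsub>L\<^esub>..\<Squnion>\<^bsub>L\<^esub> (atoms L)\<rbrace>\<^bsub>L\<^esub>\<rparr>"

definition rank_gen_fun :: "'a gorder \<Rightarrow> rat fps" where
  "rank_gen_fun L = Abs_fps (\<lambda>k. of_nat (card {p \<in> carrier L. rank L p = k}))"


section \<open>The characteristic polynomial\<close>

text \<open>The guard (a partial order and a finite interval) serves only to make the recursion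
  well-founded.\<close>

function mobius :: "'a gorder \<Rightarrow> 'a \<Rightarrow> 'a \<Rightarrow> int" where
  "mobius P x y =
     (if partial_order P \<and> x \<in> carrier P \<and> y \<in> carrier P \<and> x \<sqsubseteq>\<^bsub>P\<^esub> y \<and> finite \<lbrace>x..y\<rbrace>\<^bsub>P\<^esub>
      then if x = y then 1 else - (\<Sum>z\<in>\<lbrace>x..y\<rbrace>\<^bsub>P\<^esub> - {y}. mobius P x z)
      else 0)"
  by pat_completeness auto
termination
proof (relation "measure (\<lambda>(P, x, y). card \<lbrace>x..y\<rbrace>\<^bsub>P\<^esub>)", goal_cases)
  case 1
  show ?case by simp
next
  case (2 P x y z)
  then interpret partial_order P by simp
  have "\<lbrace>x..z\<rbrace>\<^bsub>P\<^esub> \<subset> \<lbrace>x..y\<rbrace>\<^bsub>P\<^esub>"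
  proof (intro psubsetI subsetI)
    fix w assume "w \<in> \<lbrace>x..z\<rbrace>\<^bsub>P\<^esub>"
    then show "w \<in> \<lbrace>x..y\<rbrace>\<^bsub>P\<^esub>"
      using 2 by (auto simp: at_least_at_most_def intro: le_trans)
  next
    have "y \<in> \<lbrace>x..y\<rbrace>\<^bsub>P\<^esub>" "y \<notin> \<lbrace>x..z\<rbrace>\<^bsub>P\<^esub>"
      using 2 by (auto simp: at_least_at_most_def dest: le_antisym)
    then show "\<lbrace>x..z\<rbrace>\<^bsub>P\<^esub> \<noteq> \<lbrace>x..y\<rbrace>\<^bsub>P\<^esub>" by blast
  qed
  then show ?case using 2 by (auto intro: psubset_card_mono)
qed

declare mobius.simps [simp del]

definition char_poly_star :: "'a gorder \<Rightarrow> rat poly" where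
  "char_poly_star L = (\<Sum>p\<in>carrier L. monom (of_int (mobius L \<bottom>\<^bsub>L\<^esub> p)) (rank L p))"

section \<open>The rank two lattice with a given number of atoms\<close>

text \<open>The minimum is \<open>0\<close>, the maximum \<open>r + 1\<close>, and the atoms are \<open>1, \<dots>, r\<close>.\<close>

definition M_lattice :: "nat \<Rightarrow> nat gorder" where
  "M_lattice r = \<lparr>carrier = {0..r + 1}, eq = (=), le = (\<lambda>x y. x = y \<or> x = 0 \<or> y = r + 1)\<rparr>"

lemma maxchain_memI:
  assumes "pred_on.maxchain A R C" "p \<in> A" "\<And>c. c \<in> C \<Longrightarrow> p = c \<or> R p c \<or> R c p"
  shows "p \<in> C"
proof (rule ccontr)
  assume "p \<notin> C"
  then have "pred_on.chain A R (insert p C) \<and> C \<subset> insert p C"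
    using assms unfolding pred_on.maxchain_def pred_on.chain_def by auto
  then show False using assms(1) unfolding pred_on.maxchain_def by blast
qed

lemma maxchain_containing:
  assumes "p \<in> A"
  obtains C where "pred_on.maxchain A R C" "p \<in> C"
proof -
  define B where "B = {q \<in> A. q = p \<or> R p q \<or> R q p}"
  obtain C where C: "pred_on.maxchain B R C" using pred_on.Hausdorff by blast
  have CB: "C \<subseteq> B" and chain: "\<And>x y. x \<in> C \<Longrightarrow> y \<in> C \<Longrightarrow> R\<^sup>=\<^sup>= x y \<or> R\<^sup>=\<^sup>= y x"
    using C unfolding pred_on.maxchain_def pred_on.chain_def by auto
  have p: "p \<in> C"
    by (rule maxchain_memI[OF C]) (use assms CB in \<open>auto simp: B_def\<close>)
  have False if S: "pred_on.chain A R S" "C \<subset> S" for S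
  proof -
    have "pred_on.chain B R S"
      using S p unfolding pred_on.chain_def B_def by auto
    then show False using C S unfolding pred_on.maxchain_def by blast
  qed
  moreover have "pred_on.chain A R C"
    using CB chain unfolding pred_on.chain_def B_def by auto
  ultimately have "pred_on.maxchain A R C"
    unfolding pred_on.maxchain_def by blast
  then show thesis using p that by blast
qed

lemma M_lattice_simps [simp]:
  "carrier (M_lattice r) = {0..r + 1}"
  "x .=\<^bsub>M_lattice r\<^esub> y \<longleftrightarrow> x = y"
  "x \<sqsubseteq>\<^bsub>M_lattice r\<^esub> y \<longleftrightarrow> x = y \<or> x = 0 \<or> y = r + 1"
  "x \<sqsubset>\<^bsub>M_lattice r\<^esub> y \<longleftrightarrow> x \<noteq> y \<and> (x = 0 \<or> y = r + 1)"
  by (auto simp: M_lattice_def lless_def)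

lemma partial_order_M_lattice: "partial_order (M_lattice r)"
  by unfold_locales (auto simp: M_lattice_def)

lemma lattice_M_lattice: "lattice (M_lattice r)"
proof -
  interpret partial_order "M_lattice r" by (rule partial_order_M_lattice)
  show ?thesis
  proof
    fix x y assume "x \<in> carrier (M_lattice r)" "y \<in> carrier (M_lattice r)"
    then show "\<exists>s. least (M_lattice r) s (Upper (M_lattice r) {x, y})"
      by (intro exI[of _ "if x = y then x else if x = 0 then y else if y = 0 then x else r + 1"])
         (auto simp: least_def Upper_def)
  next
    fix x y assume "x \<in> carrier (M_lattice r)" "y \<in> carrier (M_lattice r)"
    then show "\<exists>s. greatest (M_lattice r) s (Lower (M_lattice r) {x, y})"
      by (intro exI[of _ "if x = y then x else if x = r + 1 then y else if y = r + 1 then x else 0"])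
         (auto simp: greatest_def Lower_def)
  qed
qed

lemma bottom_M_lattice [simp]: "\<bottom>\<^bsub>M_lattice r\<^esub> = 0"
  unfolding bottom_def by (rule some_equality) (auto simp: least_def)

lemma atoms_M_lattice:
  assumes "r \<ge> 1"
  shows "atoms (M_lattice r) = {1..r}"
proof -
  have "\<not> covered_by (M_lattice r) 0 (Suc r)"
    using assms by (auto simp: covered_by_def intro!: bexI[of _ 1])
  then show ?thesis
    using assms by (auto simp: atoms_def covered_by_def le_Suc_eq)
qed

text \<open>\<^const>\<open>M_lattice\<close> is, up to isomorphism, the unique finite graded lattice of rank two
  with exactly \<open>r\<close> atoms.\<close>

lemma finite_graded_M_lattice:
  assumes "r \<ge> 1"
  shows "finite_graded_lattice (M_lattice r) 2" and "card (atoms (M_lattice r)) = r"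
proof -
  let ?L = "M_lattice r" and ?\<rho> = "\<lambda>p. if p = 0 then 0 else if p = r + 1 then 2 else 1 :: nat"
  show "card (atoms ?L) = r" using assms by (simp add: atoms_M_lattice)
  have "rank_function ?L (enat 2) ?\<rho>"
    unfolding rank_function_def
  proof (intro allI impI)
    fix C assume C: "pred_on.maxchain (carrier ?L) (\<sqsubset>\<^bsub>?L\<^esub>) C"
    then have sub: "C \<subseteq> {0..r + 1}"
      and chain: "\<And>x y. x \<in> C \<Longrightarrow> y \<in> C \<Longrightarrow> x = y \<or> x \<sqsubset>\<^bsub>?L\<^esub> y \<or> y \<sqsubset>\<^bsub>?L\<^esub> x"
      unfolding pred_on.maxchain_def pred_on.chain_def by auto
    have 0: "0 \<in> C" by (rule maxchain_memI[OF C]) (auto)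
    have 1: "r + 1 \<in> C" by (rule maxchain_memI[OF C]) (auto)
    have "\<exists>i\<in>C. i \<in> {1..r}"
    proof (rule ccontr)
      assume *: "\<not> (\<exists>i\<in>C. i \<in> {1..r})"
      have "c = 0 \<or> c = r + 1" if "c \<in> C" for c
        using * sub that by (fastforce simp: Suc_le_eq le_Suc_eq)
      then have "1 \<in> C" by (intro maxchain_memI[OF C]) auto
      then show False using * assms by auto
    qed
    then obtain i where i: "i \<in> C" "i \<in> {1..r}" by blast
    have "c = 0 \<or> c = i \<or> c = r + 1" if "c \<in> C" for c
      using chain[OF that i(1)] i(2) by auto
    then have "C = {0, i, r + 1}" using 0 1 i by blast
    moreover have "{j. enat j \<le> enat 2} = {0, 1, 2}" by auto
    ultimately have "C = (\<lambda>j. if j = 0 then 0 else if j = 1 then i else r + 1) ` {j. enat j \<le> enat 2}"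
      by auto
    then show "\<exists>x. C = x ` {j. enat j \<le> enat 2} \<and> least ?L (x 0) (carrier ?L) \<and>
        (\<forall>j. enat (Suc j) \<le> enat 2 \<longrightarrow> covered_by ?L (x j) (x (Suc j))) \<and>
        (\<forall>j. enat j \<le> enat 2 \<longrightarrow> ?\<rho> (x j) = j)"
      using i(2)
      by (intro exI[of _ "\<lambda>j. if j = 0 then 0 else if j = 1 then i else r + 1"])
         (auto simp: least_def covered_by_def)
  qed
  then show "finite_graded_lattice ?L 2"
    unfolding finite_graded_lattice_def using lattice_M_lattice by auto
qed

lemma M_lattice_unique:
  assumes "finite_graded_lattice L 2" and "card (atoms L) = r"
  shows "order_isomorphic L (M_lattice r)"
proof -
  from assms(1) obtain \<rho> where L: "lattice L" and fin: "finite (carrier L)"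
    and \<rho>: "rank_function L (enat 2) \<rho>"
    unfolding finite_graded_lattice_def by blast
  interpret lattice L by (rule L)
  have chain3: "\<exists>a b c. C = {a, b, c} \<and> least L a (carrier L) \<and> covered_by L a b \<and> covered_by L b c"
    if "pred_on.maxchain (carrier L) (\<sqsubset>\<^bsub>L\<^esub>) C" for C
  proof -
    from \<rho> that obtain x :: "nat \<Rightarrow> 'a" where x: "C = x ` {i. enat i \<le> enat 2}" "least L (x 0) (carrier L)"
      "\<forall>i. enat (Suc i) \<le> enat 2 \<longrightarrow> covered_by L (x i) (x (Suc i))"
      unfolding rank_function_def by blast
    have "{j. enat j \<le> enat 2} = {0, 1, 2}" by auto
    then have "C = {x 0, x 1, x 2}" using x(1) by auto
    moreover have "covered_by L (x 0) (x 1)" "covered_by L (x 1) (x 2)"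
      using x(3)[rule_format, of 0] x(3)[rule_format, of 1] by (auto simp: numeral_2_eq_2)
    ultimately show ?thesis using x(2) by blast
  qed
  obtain C0 where C0: "pred_on.maxchain (carrier L) (\<sqsubset>\<^bsub>L\<^esub>) C0"
    using pred_on.Hausdorff by blast
  obtain a b0 t where C0': "C0 = {a, b0, t}" and a: "least L a (carrier L)"
    and ab0: "covered_by L a b0" and b0t: "covered_by L b0 t"
    using chain3[OF C0] by blast
  have bot: "\<bottom>\<^bsub>L\<^esub> = a"
    unfolding bottom_def by (rule some_equality[where P = "\<lambda>x. least L x (carrier L)"])
      (use a least_unique in blast)+
  have a': "a \<in> carrier L" "\<And>x. x \<in> carrier L \<Longrightarrow> a \<sqsubseteq>\<^bsub>L\<^esub> x"
    using a by (auto simp: least_def)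
  have cov: "x \<in> carrier L" "y \<in> carrier L" "x \<sqsubseteq>\<^bsub>L\<^esub> y" "x \<noteq> y" if "covered_by L x y" for x y
    using that by (auto simp: covered_by_def lless_def eq_is_equal)
  have top: "q \<sqsubseteq>\<^bsub>L\<^esub> z" if C: "pred_on.maxchain (carrier L) (\<sqsubset>\<^bsub>L\<^esub>) {x, y, z}"
    and xy: "covered_by L x y" and yz: "covered_by L y z" and q: "q \<in> carrier L" for x y z q
  proof -
    obtain u where "least L u (Upper L {z, q})"
      using sup_of_two_exists[OF cov(2)[OF yz] q] by blast
    then have u: "u \<in> carrier L" "z \<sqsubseteq>\<^bsub>L\<^esub> u" "q \<sqsubseteq>\<^bsub>L\<^esub> u"
      using q cov(2)[OF yz] by (auto simp: least_def Upper_def)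
    note c = cov[OF xy] cov[OF yz]
    have yu: "y \<sqsubseteq>\<^bsub>L\<^esub> u" using le_trans[OF c(7) u(2)] c u(1) by blast
    have xu: "x \<sqsubseteq>\<^bsub>L\<^esub> u" using le_trans[OF c(3) yu] c u(1) by blast
    have "u \<in> {x, y, z}"
      by (rule maxchain_memI[OF C u(1)]) (use xu yu u(2) in \<open>auto simp: lless_def eq_is_equal\<close>)
    moreover have "u \<noteq> y" using le_antisym[OF c(7)] u(2) c by blast
    moreover have "u \<noteq> x" using le_antisym[OF c(3)] yu c by blast
    ultimately show ?thesis using u(3) by blast
  qed
  have t: "t \<in> carrier L" "\<And>q. q \<in> carrier L \<Longrightarrow> q \<sqsubseteq>\<^bsub>L\<^esub> t"
    using cov(2)[OF b0t] top[OF C0[unfolded C0'] ab0 b0t] by auto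
  have cases: "p = a \<or> p \<in> atoms L \<or> p = t" if p: "p \<in> carrier L" for p
  proof -
    obtain C where C: "pred_on.maxchain (carrier L) (\<sqsubset>\<^bsub>L\<^esub>) C" "p \<in> C"
      using maxchain_containing[OF p] by blast
    obtain x y z where C': "C = {x, y, z}" and x: "least L x (carrier L)"
      and xy: "covered_by L x y" and yz: "covered_by L y z"
      using chain3[OF C(1)] by blast
    have "x = a" using least_unique[OF x a] .
    moreover have "z = t"
      using top[OF C(1)[unfolded C'] xy yz t(1)] t cov(2)[OF yz] by (blast intro: le_antisym)
    moreover have "y \<in> atoms L" using xy \<open>x = a\<close> by (simp add: atoms_def bot)
    ultimately show ?thesis using C(2) C' by blast
  qed
  have atom: "p \<in> carrier L" "p \<noteq> a" if "p \<in> atoms L" for p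
    using that cov(2,4)[of a p] by (auto simp: atoms_def bot)
  have atom_min: "q = a \<or> q = p" if p: "p \<in> atoms L" and "q \<in> carrier L" "q \<sqsubseteq>\<^bsub>L\<^esub> p" for p q
    using that a'(2)[of q] by (auto simp: atoms_def bot covered_by_def lless_def eq_is_equal)
  have "t \<noteq> a"
    using cov[OF ab0] cov[OF b0t] le_antisym by blast
  have "t \<notin> atoms L"
    using atom_min[of t b0] cov[OF ab0] cov[OF b0t] by blast
  have car: "carrier L = {a, t} \<union> atoms L" using cases a'(1) t(1) atom by blast
  have "finite (atoms L)" using fin car by simp
  then obtain g where g: "bij_betw g (atoms L) {1..r}"
    using finite_same_card_bij[of "atoms L" "{1..r}"] assms(2) by auto
  define f where "f p = (if p = a then 0 else if p = t then r + 1 else g p)" for p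
  have gr: "g p \<ge> 1" "g p \<le> r" if "p \<in> atoms L" for p
    using bij_betwE[OF g] that by auto
  have f_atom: "f p = g p" if "p \<in> atoms L" for p
    using atom[OF that] that \<open>t \<notin> atoms L\<close> by (auto simp: f_def)
  have f_bot: "f a = 0" and f_top: "f t = r + 1" using \<open>t \<noteq> a\<close> by (simp_all add: f_def)
  have inj: "inj_on f (carrier L)"
  proof (rule inj_onI)
    fix p q assume p: "p \<in> carrier L" and q: "q \<in> carrier L" and eq: "f p = f q"
    have f_lt: "f s \<noteq> 0 \<and> f s \<noteq> r + 1" if "s \<in> atoms L" for s
      using gr[OF that] f_atom[OF that] by simp
    have "p = q" if "p \<in> atoms L" "q \<in> atoms L"
      using inj_onD[OF bij_betw_imp_inj_on[OF g], of p q] that eq f_atom by simp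
    then show "p = q"
      using cases[OF p] cases[OF q] f_lt[of p] f_lt[of q] eq f_bot f_top by (elim disjE) simp_all
  qed
  have surj: "f ` carrier L = {0..r + 1}"
  proof -
    have "f ` atoms L = {1..r}" using bij_betw_imp_surj_on[OF g] f_atom by simp
    then have "f ` carrier L = {0, r + 1} \<union> {1..r}" unfolding car by (auto simp: f_bot f_top)
    also have "\<dots> = {0..r + 1}" by auto
    finally show ?thesis .
  qed
  have bij: "bij_betw f (carrier L) (carrier (M_lattice r))"
    using inj surj by (simp add: bij_betw_def)
  have le: "p \<sqsubseteq>\<^bsub>L\<^esub> q \<longleftrightarrow> p = q \<or> p = a \<or> q = t" if p: "p \<in> carrier L" and q: "q \<in> carrier L" for p q
  proof
    assume pq: "p \<sqsubseteq>\<^bsub>L\<^esub> q"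
    from cases[OF q] show "p = q \<or> p = a \<or> q = t"
      using pq p atom_min[of q p] le_antisym[of p a] a' by blast
  next
    assume "p = q \<or> p = a \<or> q = t"
    then show "p \<sqsubseteq>\<^bsub>L\<^esub> q" using p q a' t by auto
  qed
  have "order_emb L (M_lattice r) f"
    unfolding order_emb_def
  proof (intro conjI ballI)
    show "weak_partial_order L" ..
    show "weak_partial_order (M_lattice r)"
      using partial_order_M_lattice by (rule partial_order.axioms(1))
    fix p q assume p: "p \<in> carrier L" and q: "q \<in> carrier L"
    have "f p = f q \<longleftrightarrow> p = q" "f p = 0 \<longleftrightarrow> p = a" "f q = r + 1 \<longleftrightarrow> q = t"
      using inj_on_eq_iff[OF inj p q] inj_on_eq_iff[OF inj p a'(1)] inj_on_eq_iff[OF inj q t(1)]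
      by (simp_all add: f_bot f_top)
    then show "f p \<sqsubseteq>\<^bsub>M_lattice r\<^esub> f q \<longleftrightarrow> p \<sqsubseteq>\<^bsub>L\<^esub> q" by (simp add: le[OF p q])
  qed
  then show ?thesis using bij unfolding order_isomorphic_def by blast
qed

end

theory Submission
  imports Defs "HOL-Library.Sublist"
begin

text \<open>The rules \<open>i 1 \<rightarrow> 1 1\<close> turn every letter in front of the last \<open>1\<close> of a word into \<open>1\<close>, so elements
  are uniquely words \<open>1\<^sup>k w\<close> with \<open>1\<close> not in \<open>w\<close>. Such an element divides \<open>v\<close> iff \<open>1\<^sup>k w\<close> is a prefix of
  the normal form of \<open>v\<close>, or that normal form starts with more than \<open>k + |w|\<close> letters \<open>1\<close>. Hence two
  incomparable elements \<open>a\<close>, \<open>b\<close> have the least common right multiple \<open>1\<^sup>m\<close> with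
  \<open>m = max |a| |b| + 1\<close>; for two atoms this is \<open>1 1\<close>, which is therefore the top of the core. Deleting
  the last letter of a normal form gives \<open>a\<^sub>k\<^sub>+\<^sub>1 = 1 + (r - 1) a\<^sub>k\<close> for the number \<open>a\<^sub>k\<close> of elements of
  length \<open>k\<close>. Word length is the rank, and left multiplication by \<open>p\<close> maps the whole order onto
  the filter above \<open>p\<close>.\<close>

section \<open>Ranks and isomorphisms of posets\<close>

text \<open>The enumeration of the chain is strictly increasing, so exactly \<open>x 0\<close>, ...,
  \<open>x (i - 1)\<close> lie below \<open>x i\<close>. The count mentions neither
  \<open>\<rho>\<close> nor \<open>N\<close>, so all rank functions agree on the carrier.\<close>

lemma rank_function_eq_card:
  assumes "partial_order P" and "rank_function P N \<rho>"
    and C: "pred_on.maxchain (carrier P) (\<sqsubset>\<^bsub>P\<^esub>) C" and p: "p \<in> C"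
  shows "\<rho> p = card {c \<in> C. c \<sqsubset>\<^bsub>P\<^esub> p}"
proof -
  interpret partial_order P by fact
  have sub: "C \<subseteq> carrier P"
    using C unfolding pred_on.maxchain_def pred_on.chain_def by auto
  obtain x where x: "C = x ` {i. enat i \<le> N}"
    and cov: "\<And>i. enat (Suc i) \<le> N \<Longrightarrow> covered_by P (x i) (x (Suc i))"
    and \<rho>: "\<And>i. enat i \<le> N \<Longrightarrow> \<rho> (x i) = i"
    using assms(2) C unfolding rank_function_def by blast
  have down: "enat i \<le> N" if "i \<le> j" "enat j \<le> N" for i j
    using order_trans[of "enat i" "enat j" N] that by simp
  have carr: "x i \<in> carrier P" if "enat i \<le> N" for i
    using sub x that by blast
  have less: "x i \<sqsubset>\<^bsub>P\<^esub> x j" if "i < j" "enat j \<le> N" for i j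
    using that
  proof (induction j)
    case (Suc j)
    have j: "enat j \<le> N" by (rule down[OF _ Suc.prems(2)]) simp
    have step: "x j \<sqsubset>\<^bsub>P\<^esub> x (Suc j)" using cov[OF Suc.prems(2)] by (simp add: covered_by_def)
    show ?case
    proof (cases "i = j")
      case False
      then have "i < j" using Suc.prems by simp
      moreover have "enat i \<le> N" by (rule down[OF _ j]) (use \<open>i < j\<close> in simp)
      ultimately show ?thesis
        using lless_trans[OF Suc.IH[OF _ j] step] carr j Suc.prems(2) by blast
    qed (use step in simp)
  qed simp
  have irrefl: "\<not> a \<sqsubset>\<^bsub>P\<^esub> a" for a by (simp add: lless_def eq_is_equal)
  from p x obtain i where i: "p = x i" "enat i \<le> N" by auto
  have lt: "x j \<sqsubset>\<^bsub>P\<^esub> x i \<longleftrightarrow> j < i" if j: "enat j \<le> N" for j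
  proof -
    have "\<not> x j \<sqsubset>\<^bsub>P\<^esub> x i" if "i < j"
      using lless_trans[OF less[OF that j]] irrefl carr i(2) j by blast
    then show ?thesis
      using less[OF _ i(2), of j] irrefl by (cases i j rule: linorder_cases) auto
  qed
  have lt_down: "enat j \<le> N" if "j < i" for j
    using down[OF _ i(2)] that by simp
  then have "{c \<in> C. c \<sqsubset>\<^bsub>P\<^esub> p} = x ` {..<i}"
    unfolding x i(1) by (auto simp: lt)
  moreover have "inj_on x {..<i}"
    by (rule inj_on_inverseI[of _ \<rho>]) (use lt_down \<rho> in simp)
  ultimately show ?thesis using \<rho>[OF i(2)] i(1) by (simp add: card_image)
qed

text \<open>\<open>rank P\<close> is a Hilbert choice whose bound may differ from \<open>N\<close>;
  the preceding count is insensitive to that.\<close>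

lemma rank_eq_card:
  assumes "partial_order P" and "rank_function P N \<rho>"
    and "pred_on.maxchain (carrier P) (\<sqsubset>\<^bsub>P\<^esub>) C" and "p \<in> C"
  shows "rank P p = card {c \<in> C. c \<sqsubset>\<^bsub>P\<^esub> p}"
proof -
  have "\<exists>N. rank_function P N (rank P)"
    unfolding rank_def
    by (rule someI[of "\<lambda>\<rho>. \<exists>N. rank_function P N \<rho>", OF exI, OF assms(2)])
  then obtain N' where "rank_function P N' (rank P)" ..
  from rank_function_eq_card[OF assms(1) this assms(3,4)] show ?thesis .
qed

lemma rank_eqI:
  assumes "partial_order P" and "rank_function P N \<rho>" and "p \<in> carrier P"
  shows "rank P p = \<rho> p"
proof -
  obtain C where "pred_on.maxchain (carrier P) (\<sqsubset>\<^bsub>P\<^esub>) C" "p \<in> C"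
    using maxchain_containing[OF assms(3)] by blast
  from rank_eq_card[OF assms(1,2) this] rank_function_eq_card[OF assms(1,2) this]
  show ?thesis by simp
qed

lemma order_isomorphic_sym:
  assumes "order_isomorphic P Q"
  shows "order_isomorphic Q P"
proof -
  obtain f where f: "order_emb P Q f" and bij: "bij_betw f (carrier P) (carrier Q)"
    using assms unfolding order_isomorphic_def by blast
  let ?g = "the_inv_into (carrier P) f"
  have inv: "?g y \<in> carrier P" "f (?g y) = y" if "y \<in> carrier Q" for y
    using that bij by (auto simp: bij_betw_def the_inv_into_into f_the_inv_into_f)
  have "order_emb Q P ?g"
    using f inv unfolding order_emb_def by metis
  then show ?thesis
    unfolding order_isomorphic_def using bij_betw_the_inv_into[OF bij] by blast
qed

lemma (in partial_order) bottom_eqI: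
  assumes "least L a (carrier L)"
  shows "\<bottom> = a"
  unfolding bottom_def by (rule some_equality) (use assms least_unique in blast)+

lemma (in partial_order) sup_eqI:
  assumes "least L a (Upper L A)"
  shows "\<Squnion>A = a"
  unfolding sup_def by (rule some_equality) (use assms least_unique in blast)+

section \<open>Monoids with an additive length\<close>

lemma left_div_order_simps [simp]:
  "carrier (left_div_order G) = carrier G"
  "x .=\<^bsub>left_div_order G\<^esub> y \<longleftrightarrow> x = y"
  "x \<sqsubseteq>\<^bsub>left_div_order G\<^esub> y \<longleftrightarrow> x divides\<^bsub>G\<^esub> y"
  "x \<sqsubset>\<^bsub>left_div_order G\<^esub> y \<longleftrightarrow> x divides\<^bsub>G\<^esub> y \<and> x \<noteq> y"
  by (auto simp: left_div_order_def lless_def)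

text \<open>This is what the order theory uses of a homogeneous presentation: proper divisors are
  shorter, elements of length one act as generators, and \<open>generator_exists\<close> lets every
  element be extended on the right.\<close>

locale graded_monoid = monoid G for G :: "('a, 'b) monoid_scheme" (structure) +
  fixes len :: "'a \<Rightarrow> nat"
  assumes len_mult: "a \<in> carrier G \<Longrightarrow> b \<in> carrier G \<Longrightarrow> len (a \<otimes> b) = len a + len b"
    and len_eq_0D: "a \<in> carrier G \<Longrightarrow> len a = 0 \<Longrightarrow> a = \<one>"
    and generator_divides: "a \<in> carrier G \<Longrightarrow> len a \<noteq> 0 \<Longrightarrow> \<exists>s\<in>carrier G. len s = 1 \<and> s divides a"
    and generator_exists: "\<exists>s\<in>carrier G. len s = 1"
begin

lemma len_one: "len \<one> = 0"
  using len_mult[of \<one> \<one>] by simp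

lemma divides_len_le:
  assumes "a divides b" "a \<in> carrier G"
  shows "len a \<le> len b"
  using assms len_mult unfolding factor_def by auto

text \<open>By additivity the cofactor has length 0, hence is \<open>\<one>\<close>. Antisymmetry of
  divisibility rests on this.\<close>

lemma divides_len_eqD:
  assumes "a divides b" "a \<in> carrier G" "len a = len b"
  shows "a = b"
  using assms len_mult len_eq_0D unfolding factor_def by force

lemma partial_order_left_div: "partial_order (left_div_order G)"
proof
  fix x y z
  assume "x \<sqsubseteq>\<^bsub>left_div_order G\<^esub> y" "y \<sqsubseteq>\<^bsub>left_div_order G\<^esub> z"
    "x \<in> carrier (left_div_order G)" "y \<in> carrier (left_div_order G)" "z \<in> carrier (left_div_order G)"
  then show "x \<sqsubseteq>\<^bsub>left_div_order G\<^esub> z" by (auto intro: divides_trans)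
next
  fix x y
  assume "x \<sqsubseteq>\<^bsub>left_div_order G\<^esub> y" "y \<sqsubseteq>\<^bsub>left_div_order G\<^esub> x"
    "x \<in> carrier (left_div_order G)" "y \<in> carrier (left_div_order G)"
  then show "x .=\<^bsub>left_div_order G\<^esub> y"
    using divides_len_eqD divides_len_le by (simp add: le_antisym)
qed (auto simp: fun_eq_iff)

lemma least_one: "least (left_div_order G) \<one> (carrier (left_div_order G))"
  by (auto simp: least_def factor_def)

lemma bottom_left_div: "\<bottom>\<^bsub>left_div_order G\<^esub> = \<one>"
  by (rule partial_order.bottom_eqI[OF partial_order_left_div least_one])

text \<open>Multiply \<open>a\<close> by a left divisor of length one of the cofactor. Divisibility
  thus skips no length, which makes length a rank.\<close>

lemma divides_generator_between:
  assumes ab: "a divides b" "a \<noteq> b" and carr: "a \<in> carrier G" "b \<in> carrier G"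
  shows "\<exists>d\<in>carrier G. len d = Suc (len a) \<and> a divides d \<and> d divides b"
proof -
  obtain c where c: "c \<in> carrier G" "b = a \<otimes> c" using ab(1) unfolding factor_def by blast
  then have "len c \<noteq> 0" using ab(2) len_eq_0D[of c] carr by (metis r_one)
  then obtain s e where s: "s \<in> carrier G" "len s = 1" "e \<in> carrier G" "c = s \<otimes> e"
    using generator_divides[OF c(1)] unfolding factor_def by blast
  show ?thesis
  proof (intro bexI[of _ "a \<otimes> s"] conjI)
    show "a \<otimes> s divides b"
      unfolding factor_def using s c carr by (intro bexI[of _ e]) (simp_all add: m_assoc)
  qed (use s carr in \<open>auto simp: len_mult factor_def\<close>)
qed

text \<open>A maximal chain meets every length, because a missing length could be filled by an
  element comparable with the whole chain. The chain is then enumerated by length.\<close>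

lemma rank_function_left_div: "rank_function (left_div_order G) \<infinity> len"
  unfolding rank_function_def
proof (intro allI impI)
  let ?L = "left_div_order G"
  fix C assume C: "pred_on.maxchain (carrier ?L) (\<sqsubset>\<^bsub>?L\<^esub>) C"
  then have sub: "C \<subseteq> carrier G"
    unfolding pred_on.maxchain_def pred_on.chain_def by auto
  have chain: "x divides y \<or> y divides x" if "x \<in> C" "y \<in> C" for x y
  proof (cases "x = y")
    case False
    then show ?thesis using C that unfolding pred_on.maxchain_def pred_on.chain_def by auto
  qed (use that sub in auto)
  have memI: "p \<in> C" if "p \<in> carrier G" "\<And>c. c \<in> C \<Longrightarrow> p divides c \<or> c divides p" for p
    by (rule maxchain_memI[OF C]) (use that in auto)
  \<comment> \<open>Within a chain, lengths decide divisibility: if the longer element divides the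
    shorter one, both are equal.\<close>
  have le: "x divides y" if "x \<in> C" "y \<in> C" "len x \<le> len y" for x y
  proof (cases "y divides x")
    case True
    then have "len x = len y" using divides_len_le that sub by (auto intro: le_antisym)
    then have "y = x" using True divides_len_eqD that sub by auto
    then show ?thesis using True by simp
  qed (use chain that in blast)
  have ex: "\<exists>c\<in>C. len c = i" for i
  proof (induction i)
    case 0
    have "\<one> \<in> C" by (rule memI) (use sub in \<open>auto simp: factor_def\<close>)
    then show ?case using len_one by blast
  next
    case (Suc i)
    then obtain c where c: "c \<in> C" "len c = i" by blast
    have cG: "c \<in> carrier G" using c sub by blast
    \<comment> \<open>Such a \<open>d\<close> is comparable with every chain element: those of
      length at most \<open>i\<close> divide \<open>c\<close>, the longer ones are multiples of
      \<open>d\<close>. Maximality puts it in \<open>C\<close>.\<close>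
    have ext: "\<exists>c\<in>C. len c = Suc i"
      if d: "d \<in> carrier G" "len d = Suc i" "c divides d"
        and up: "\<And>e. e \<in> C \<Longrightarrow> len e > i \<Longrightarrow> d divides e" for d
    proof (rule bexI[of _ d])
      show "d \<in> C"
      proof (rule memI)
        fix e assume e: "e \<in> C"
        show "d divides e \<or> e divides d"
        proof (cases "len e \<le> i")
          case True
          then have "e divides c" using le c e by simp
          then have "e divides d" using d cG sub e by (auto intro: divides_trans)
          then show ?thesis ..
        qed (use up[OF e] in auto)
      qed (fact d)
    qed (fact d)
    show ?case
    proof (cases "\<exists>e\<in>C. len e > i")
      case True
      \<comment> \<open>A shortest chain element of length above \<open>i\<close> divides all the
        others, so an element of length \<open>Suc i\<close> between \<open>c\<close> and
        \<open>e\<close> satisfies \<open>up\<close>.\<close>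
      then obtain e where e: "e \<in> C" "len e > i" "\<And>e'. e' \<in> C \<Longrightarrow> len e' > i \<Longrightarrow> len e \<le> len e'"
        using ex_has_least_nat[of "\<lambda>e. e \<in> C \<and> len e > i" _ len] by blast
      have ce: "c divides e" "c \<noteq> e" using le c e by auto
      obtain d where d: "d \<in> carrier G" "len d = Suc (len c)" "c divides d" "d divides e"
        using divides_generator_between[OF ce cG] e sub by blast
      have "d divides e'" if e': "e' \<in> C" "len e' > i" for e'
        using divides_trans[OF d(4) le[OF e(1) e'(1) e(3)[OF e']] d(1)] .
      then show ?thesis using ext[OF d(1) _ d(3)] d(2) c(2) by simp
    next
      case False
      \<comment> \<open>No chain element is longer than \<open>c\<close>, so \<open>up\<close> is
        vacuous and \<open>c \<otimes> s\<close> serves for any \<open>s\<close> of length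
        one.\<close>
      obtain s where "s \<in> carrier G" "len s = 1" using generator_exists by blast
      then show ?thesis
        using False cG c by (intro ext[of "c \<otimes> s"]) (auto simp: len_mult factor_def)
    qed
  qed
  define x where "x i = (SOME c. c \<in> C \<and> len c = i)" for i
  have x: "x i \<in> C" "len (x i) = i" for i
    unfolding x_def using someI_ex[of "\<lambda>c. c \<in> C \<and> len c = i"] ex[of i] by auto
  have xG: "x i \<in> carrier G" for i using x sub by blast
  have "c = x (len c)" if "c \<in> C" for c
    using le[OF that x(1)] divides_len_eqD[of c] x that sub by auto
  then have "C = range x" using x by auto
  moreover have "x 0 = \<one>" using len_eq_0D x(2)[of 0] xG by blast
  moreover have "covered_by ?L (x i) (x (Suc i))" for i
  proof -
    have False if z: "z \<in> carrier G" "x i divides z" "x i \<noteq> z" "z divides x (Suc i)" "z \<noteq> x (Suc i)" for z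
    proof -
      have "i \<le> len z" "len z \<le> Suc i"
        using divides_len_le z xG x(2) by metis+
      moreover have "len z \<noteq> i" using divides_len_eqD[OF z(2) xG] z(3) x(2) by metis
      moreover have "len z \<noteq> Suc i" using divides_len_eqD[OF z(4) z(1)] z(5) x(2) by metis
      ultimately show False by simp
    qed
    moreover have "x i \<noteq> x (Suc i)" using x(2) by (metis n_not_Suc_n)
    ultimately show ?thesis
      using le[of "x i" "x (Suc i)"] x xG by (auto simp: covered_by_def)
  qed
  ultimately show "\<exists>x. C = x ` {i. enat i \<le> \<infinity>} \<and> least ?L (x 0) (carrier ?L) \<and>
      (\<forall>i. enat (Suc i) \<le> \<infinity> \<longrightarrow> covered_by ?L (x i) (x (Suc i))) \<and>
      (\<forall>i. enat i \<le> \<infinity> \<longrightarrow> len (x i) = i)"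
    using least_one x(2) by (intro exI[of _ x]) simp
qed

lemma rank_left_div: "a \<in> carrier G \<Longrightarrow> rank (left_div_order G) a = len a"
  by (rule rank_eqI[OF partial_order_left_div rank_function_left_div]) simp

text \<open>An atom has a divisor of length one, which must be the atom itself; conversely, a
  divisor of an element of length one has length 0 or 1.\<close>

lemma atoms_left_div: "atoms (left_div_order G) = {s \<in> carrier G. len s = 1}"
proof (intro equalityI subsetI)
  fix s assume s: "s \<in> atoms (left_div_order G)"
  then have sG: "s \<in> carrier G" and "\<one> divides s" "\<one> \<noteq> s"
    and cov: "\<And>z. z \<in> carrier G \<Longrightarrow> z \<noteq> \<one> \<Longrightarrow> z divides s \<Longrightarrow> z = s"
    by (auto simp: atoms_def bottom_left_div covered_by_def factor_def)
  then obtain d where "d \<in> carrier G" "len d = 1" "d divides s"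
    using divides_generator_between[of \<one> s] len_one by auto
  then show "s \<in> {s \<in> carrier G. len s = 1}"
    using cov[of d] sG len_one by force
next
  fix s assume s: "s \<in> {s \<in> carrier G. len s = 1}"
  have False if "z \<in> carrier G" "z \<noteq> \<one>" "z divides s" "z \<noteq> s" for z
    using that s divides_len_le[of z s] divides_len_eqD[of z s] len_eq_0D[of z] by (auto simp: le_Suc_eq)
  then show "s \<in> atoms (left_div_order G)"
    using s len_one by (auto simp: atoms_def bottom_left_div covered_by_def factor_def)
qed

text \<open>Meets exist because lengths are bounded on a set of common lower bounds: the join of a longest
  lower bound with any other lower bound is again a lower bound, hence equal to the longest one.\<close>

lemma lattice_left_div:
  assumes lcm: "\<And>a b. a \<in> carrier G \<Longrightarrow> b \<in> carrier G \<Longrightarrow> \<exists>c\<in>carrier G. c lcmof a b"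
  shows "lattice (left_div_order G)"
proof -
  interpret L: partial_order "left_div_order G" by (rule partial_order_left_div)
  show ?thesis
  proof
    fix x y assume "x \<in> carrier (left_div_order G)" "y \<in> carrier (left_div_order G)"
    then obtain c where "c \<in> carrier G" "c lcmof x y" using lcm by auto
    then show "\<exists>s. least (left_div_order G) s (Upper (left_div_order G) {x, y})"
      using \<open>x \<in> carrier _\<close> \<open>y \<in> carrier _\<close>
      by (intro exI[of _ c]) (auto simp: islcm_def least_def Upper_def)
  next
    fix x y assume x: "x \<in> carrier (left_div_order G)" and y: "y \<in> carrier (left_div_order G)"
    let ?P = "\<lambda>c. c \<in> carrier G \<and> c divides x \<and> c divides y"
    have "?P \<one>" using x y by (auto simp: factor_def)
    moreover have "\<forall>c. ?P c \<longrightarrow> len c < Suc (len x)" by (auto simp: less_Suc_eq_le divides_len_le)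
    ultimately obtain c where c: "?P c" and max: "\<And>d. ?P d \<Longrightarrow> len d \<le> len c"
      using ex_has_greatest_nat[of ?P \<one> len "Suc (len x)"] by auto
    have "d divides c" if d: "?P d" for d
    proof -
      obtain e where e: "e \<in> carrier G" "e lcmof d c" using lcm[of d c] c d by auto
      then have "?P e" "c divides e" "d divides e" using c d x y by (auto simp: islcm_def)
      then show ?thesis
        using max[of e] divides_len_le[of c e] divides_len_eqD[of c e] c by auto
    qed
    then show "\<exists>s. greatest (left_div_order G) s (Lower (left_div_order G) {x, y})"
      using x y c by (intro exI[of _ c]) (auto simp: greatest_def Lower_def)
  qed
qed

text \<open>Multiplication by \<open>p\<close> has the filter above \<open>p\<close> as image by the
  definition of divisibility; left cancellation makes it injective and order-reflecting.\<close>

lemma upho_lattice_left_div: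
  assumes lcm: "\<And>a b. a \<in> carrier G \<Longrightarrow> b \<in> carrier G \<Longrightarrow> \<exists>c\<in>carrier G. c lcmof a b"
    and cancel: "left_cancellative G"
    and fin: "\<And>k. finite {a \<in> carrier G. len a = k}"
  shows "upho_lattice (left_div_order G)"
  unfolding upho_lattice_def
proof (intro conjI ballI)
  let ?L = "left_div_order G"
  interpret L: partial_order ?L by (rule partial_order_left_div)
  show "lattice ?L" by (rule lattice_left_div[OF lcm])
  show "finite_type_N_graded ?L"
    unfolding finite_type_N_graded_def
    using partial_order_left_div least_one rank_function_left_div fin by auto
  obtain s where "s \<in> carrier G" "len s = 1" using generator_exists by blast
  then show "\<exists>p\<in>carrier ?L. \<exists>q\<in>carrier ?L. p \<noteq> q"
    using len_one by (intro bexI[of _ s] bexI[of _ \<one>]) auto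
  fix p assume "p \<in> carrier ?L"
  then have p: "p \<in> carrier G" by simp
  let ?F = "?L\<lparr>carrier := {q \<in> carrier ?L. p \<sqsubseteq>\<^bsub>?L\<^esub> q}\<rparr>"
  have "weak_partial_order ?F"
    using weak_partial_order_subset[OF L.weak_partial_order_axioms] by auto
  have canc: "b = c" if "p \<otimes> b = p \<otimes> c" "b \<in> carrier G" "c \<in> carrier G" for b c
    using cancel that p unfolding left_cancellative_def by blast
  have "p \<otimes> a divides p \<otimes> b \<longleftrightarrow> a divides b" if ab: "a \<in> carrier G" "b \<in> carrier G" for a b
  proof
    assume "p \<otimes> a divides p \<otimes> b"
    then obtain c where c: "c \<in> carrier G" "p \<otimes> b = p \<otimes> (a \<otimes> c)"
      using p ab by (auto simp: factor_def m_assoc)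
    then show "a divides b" using canc[OF c(2)] ab by (auto simp: factor_def)
  next
    assume "a divides b"
    then show "p \<otimes> a divides p \<otimes> b" using p ab by (auto simp: factor_def m_assoc)
  qed
  then have "order_emb ?L ?F (\<lambda>a. p \<otimes> a)"
    unfolding order_emb_def using L.weak_partial_order_axioms \<open>weak_partial_order ?F\<close> by simp
  moreover have "bij_betw (\<lambda>a. p \<otimes> a) (carrier ?L) (carrier ?F)"
    unfolding bij_betw_def by (auto intro!: inj_onI canc simp: factor_def p)
  ultimately have "order_isomorphic ?L ?F" unfolding order_isomorphic_def by blast
  then show "order_isomorphic ?F ?L" by (rule order_isomorphic_sym)
qed

end

section \<open>Homogeneous presentations\<close>

text \<open>Under a homogeneous presentation all words of a class have the same length, so the
  choice of representative is immaterial.\<close>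

definition class_length :: "'a list set \<Rightarrow> nat" where
  "class_length A = length (SOME u. u \<in> A)"

locale homogeneous_presentation =
  fixes X :: "'a set" and R :: "('a list \<times> 'a list) set"
  assumes homogeneous: "(u, v) \<in> R \<Longrightarrow> length u = length v"
begin

definition cls :: "'a list \<Rightarrow> 'a list set" where
  "cls u = pres_cong X R `` {u}"

abbreviation M :: "'a list set monoid" where
  "M \<equiv> presented_monoid X R"

lemma carrier_M: "carrier M = cls ` lists X"
  by (auto simp: presented_monoid_def quotient_def cls_def)

lemma cls_carrier: "u \<in> lists X \<Longrightarrow> cls u \<in> carrier M"
  by (simp add: carrier_M)

lemma one_M: "\<one>\<^bsub>M\<^esub> = cls []"
  by (simp add: presented_monoid_def cls_def)

lemma cls_mult: "u \<in> lists X \<Longrightarrow> v \<in> lists X \<Longrightarrow> cls u \<otimes>\<^bsub>M\<^esub> cls v = cls (u @ v)"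
  unfolding cls_def by (rule pres_cong_class_mult)

lemma cls_eq_iff: "u \<in> lists X \<Longrightarrow> v \<in> lists X \<Longrightarrow> cls u = cls v \<longleftrightarrow> (u, v) \<in> pres_cong X R"
  unfolding cls_def by (rule eq_equiv_class_iff[OF equiv_pres_cong])

lemma pres_cong_length: "(u, v) \<in> pres_cong X R \<Longrightarrow> length u = length v"
  by (induction rule: pres_cong.induct) (auto dest: homogeneous)

lemma class_length_cls:
  assumes "u \<in> lists X"
  shows "class_length (cls u) = length u"
proof -
  have "u \<in> cls u" using assms by (simp add: cls_def pres_cong.refl)
  then have "(SOME v. v \<in> cls u) \<in> cls u" by (rule someI)
  then show ?thesis unfolding class_length_def using pres_cong_length by (fastforce simp: cls_def)
qed

lemma cls_divides_iff:
  assumes "u \<in> lists X" "v \<in> lists X"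
  shows "cls u divides\<^bsub>M\<^esub> cls v \<longleftrightarrow> (\<exists>w\<in>lists X. (u @ w, v) \<in> pres_cong X R)"
proof -
  have "cls u divides\<^bsub>M\<^esub> cls v \<longleftrightarrow> (\<exists>w\<in>lists X. cls v = cls u \<otimes>\<^bsub>M\<^esub> cls w)"
    unfolding factor_def carrier_M by blast
  also have "\<dots> \<longleftrightarrow> (\<exists>w\<in>lists X. cls v = cls (u @ w))"
    by (rule bex_cong) (simp_all add: cls_mult assms)
  also have "\<dots> \<longleftrightarrow> (\<exists>w\<in>lists X. (u @ w, v) \<in> pres_cong X R)"
    using assms by (intro bex_cong refl) (auto simp flip: cls_eq_iff)
  finally show ?thesis .
qed

text \<open>The first letter of a nonempty word is its divisor of length one, and
  \<open>X \<noteq> {}\<close> supplies an element of length one.\<close>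

lemma graded_monoid_presented:
  assumes "X \<noteq> {}"
  shows "graded_monoid M class_length"
proof (intro graded_monoid.intro graded_monoid_axioms.intro)
  show "monoid M" by (rule monoid_presented_monoid)
next
  fix a b assume "a \<in> carrier M" "b \<in> carrier M"
  then obtain u v where uv: "a = cls u" "b = cls v" "u \<in> lists X" "v \<in> lists X"
    unfolding carrier_M by blast
  then have "u @ v \<in> lists X" by simp
  then show "class_length (a \<otimes>\<^bsub>M\<^esub> b) = class_length a + class_length b"
    unfolding uv(1,2) cls_mult[OF uv(3,4)]
    using class_length_cls uv(3,4) by (metis length_append)
next
  fix a assume "a \<in> carrier M" "class_length a = 0"
  then obtain u where "a = cls u" "u \<in> lists X" "class_length (cls u) = 0"
    unfolding carrier_M by blast
  then show "a = \<one>\<^bsub>M\<^esub>" unfolding one_M by (simp add: class_length_cls del: in_lists_conv_set)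
next
  fix a assume "a \<in> carrier M" "class_length a \<noteq> 0"
  then obtain u where u: "a = cls u" "u \<in> lists X" "class_length (cls u) \<noteq> 0"
    unfolding carrier_M by blast
  then have "u \<noteq> []" using class_length_cls by force
  then obtain x v where xv: "u = [x] @ v" by (metis append_Cons append_Nil neq_Nil_conv)
  then have l: "[x] \<in> lists X" "v \<in> lists X" using u by auto
  show "\<exists>s\<in>carrier M. class_length s = 1 \<and> s divides\<^bsub>M\<^esub> a"
  proof (intro bexI[of _ "cls [x]"] conjI)
    show "cls [x] divides\<^bsub>M\<^esub> a"
      unfolding u(1) cls_divides_iff[OF l(1) u(2)] using l u(2) xv by (intro bexI[of _ v]) (auto intro!: pres_cong.refl)
  qed (use l in \<open>auto simp: class_length_cls cls_carrier\<close>)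
next
  obtain x where "x \<in> X" using assms by blast
  then show "\<exists>s\<in>carrier M. class_length s = 1"
    by (intro bexI[of _ "cls [x]"]) (auto simp: class_length_cls cls_carrier)
qed

lemma finite_class_length:
  assumes "finite X"
  shows "finite {a \<in> carrier M. class_length a = k}"
proof (rule finite_subset)
  show "{a \<in> carrier M. class_length a = k} \<subseteq> cls ` {u. set u \<subseteq> X \<and> length u = k}"
  proof
    fix a assume a: "a \<in> {a \<in> carrier M. class_length a = k}"
    then obtain u where "a = cls u" "u \<in> lists X"
      unfolding carrier_M by blast
    moreover from this have "length u = k" using a class_length_cls by simp
    ultimately show "a \<in> cls ` {u. set u \<subseteq> X \<and> length u = k}" by auto
  qed
  show "finite (cls ` {u. set u \<subseteq> X \<and> length u = k})"
    using finite_lists_length_eq[OF assms] by simp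
qed

end

section \<open>The monoid \<open>\<langle>x\<^sub>1, \<dots>, x\<^sub>r | x\<^sub>i x\<^sub>1 = x\<^sub>1\<^sup>2\<rangle>\<close>\<close>

definition gens :: "nat \<Rightarrow> nat set" where
  "gens r = {1..r}"

definition rels :: "nat \<Rightarrow> (nat list \<times> nat list) set" where
  "rels r = {([i, 1], [1, 1]) | i. i \<in> {2..r}}"

text \<open>A tail without \<open>1\<close> has nothing to rewrite, so the last branch leaves it
  untouched.\<close>

fun nf :: "nat list \<Rightarrow> nat list" where
  "nf [] = []"
| "nf (x # u) = (if 1 \<in> set u then 1 # nf u else x # u)"

lemma nf_id: "1 \<notin> set u \<Longrightarrow> nf u = u"
  by (cases u) auto

lemma length_nf [simp]: "length (nf u) = length u"
  by (induction u) auto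

lemma one_in_nf [simp]: "1 \<in> set (nf u) \<longleftrightarrow> 1 \<in> set u"
  by (induction u) auto

text \<open>A \<open>1\<close> in \<open>v\<close> overwrites all of \<open>u\<close>, of which only
  the length survives; without one, \<open>v\<close> stays as it is and does not affect
  \<open>u\<close>.\<close>

lemma nf_append: "nf (u @ v) = (if 1 \<in> set v then replicate (length u) 1 @ nf v else nf u @ v)"
  by (induction u) (auto simp: nf_id)

lemma nf_starts_with_one: "1 \<in> set u \<Longrightarrow> \<exists>w. nf u = 1 # w"
  by (cases u) auto

lemma nf_replicate [simp]: "nf (replicate n 1) = replicate n 1"
  by (induction n) (auto simp: nf_id)

lemma nf_nf [simp]: "nf (nf u) = nf u"
  by (induction u) auto

lemma nf_lists: "u \<in> lists X \<Longrightarrow> 1 \<in> X \<Longrightarrow> nf u \<in> lists X"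
  by (induction u) auto

text \<open>This is left cancellation on words: both sides of \<open>nf_append\<close> expose the
  right factor as the suffix of a fixed length.\<close>

lemma nf_append_cancel:
  assumes "nf (u @ v) = nf (u @ w)"
  shows "nf v = nf w"
proof -
  have "length v = length w"
    using arg_cong[OF assms, of length] by simp
  have eq: "nf v' = nf w'"
    if eq: "nf (u @ v') = nf (u @ w')" and len: "length v' = length w'" and v': "1 \<in> set v'" for v' w'
  proof -
    \<comment> \<open>If only \<open>v'\<close> contained a \<open>1\<close>, comparing suffixes
      would give \<open>nf v' = w'\<close>, with a \<open>1\<close> on the left side only.\<close>
    have "1 \<in> set w'"
    proof (rule ccontr)
      assume "1 \<notin> set w'"
      then have "nf v' = w'" using eq v' len by (simp add: nf_append)
      then show False using one_in_nf[of v'] v' \<open>1 \<notin> set w'\<close> by simp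
    qed
    then show ?thesis using eq v' by (simp add: nf_append)
  qed
  consider "1 \<in> set v" | "1 \<in> set w" | "1 \<notin> set v" "1 \<notin> set w" by blast
  then show ?thesis
  proof cases
    case 3
    then show ?thesis using assms by (simp add: nf_append nf_id)
  qed (use eq[of v w] eq[of w v] assms \<open>length v = length w\<close> in simp_all)
qed

text \<open>A final \<open>1\<close> forces every earlier letter to be \<open>1\<close>; any other
  final letter puts no condition on what precedes it. The recursion for the count comes from
  this.\<close>

lemma nf_snoc_eq_self_iff:
  "nf (u @ [x]) = u @ [x] \<longleftrightarrow> (if x = 1 then u = replicate (length u) 1 else nf u = u)"
  by (auto simp: nf_append)

section \<open>Counting normal words by length\<close>

definition normal_words :: "nat \<Rightarrow> nat \<Rightarrow> nat list set" where
  "normal_words r k = {u \<in> lists (gens r). length u = k \<and> nf u = u}"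

lemma normal_words_0: "normal_words r 0 = {[]}"
  by (auto simp: normal_words_def gens_def)

lemma normal_words_Suc:
  assumes "r \<ge> 1"
  shows "normal_words r (Suc k) =
    insert (replicate (Suc k) 1) ((\<lambda>(u, x). u @ [x]) ` (normal_words r k \<times> {2..r}))"
proof (intro equalityI subsetI)
  fix v assume v: "v \<in> normal_words r (Suc k)"
  then obtain u x where ux: "v = u @ [x]" by (auto simp: normal_words_def gens_def length_Suc_conv_rev)
  show "v \<in> insert (replicate (Suc k) 1) ((\<lambda>(u, x). u @ [x]) ` (normal_words r k \<times> {2..r}))"
  proof (cases "x = 1")
    case True
    then have "u = replicate k 1" using v nf_snoc_eq_self_iff[of u x] by (auto simp: ux normal_words_def gens_def)
    then show ?thesis using True ux by (simp flip: replicate_append_same)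
  next
    case False
    then have "(u, x) \<in> normal_words r k \<times> {2..r}"
      using v nf_snoc_eq_self_iff[of u x] by (auto simp: ux normal_words_def gens_def)
    then show ?thesis unfolding ux by (intro insertI2 image_eqI[of _ _ "(u, x)"]) simp_all
  qed
next
  fix v assume "v \<in> insert (replicate (Suc k) 1) ((\<lambda>(u, x). u @ [x]) ` (normal_words r k \<times> {2..r}))"
  then show "v \<in> normal_words r (Suc k)"
    using assms nf_replicate[of "Suc k"]
    by (auto simp: normal_words_def gens_def nf_append nf_id simp del: nf_replicate)
qed

lemma finite_normal_words: "finite (normal_words r k)"
proof -
  have "normal_words r k \<subseteq> {u. set u \<subseteq> {1..r} \<and> length u = k}"
    by (auto simp: normal_words_def gens_def)
  then show ?thesis using finite_lists_length_eq[of "{1..r}" k] finite_subset by blast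
qed

lemma card_normal_words_Suc:
  assumes "r \<ge> 1"
  shows "card (normal_words r (Suc k)) = Suc ((r - 1) * card (normal_words r k))"
proof -
  let ?S = "(\<lambda>(u, x). u @ [x]) ` (normal_words r k \<times> {2..r})"
  have "card ?S = card (normal_words r k \<times> {2..r})"
    by (intro card_image) (auto simp: inj_on_def)
  \<comment> \<open>The all-ones word ends in \<open>1\<close>, the words in \<open>?S\<close> in a
    letter at least 2, so the insertion adds one to the count.\<close>
  moreover have "replicate (Suc k) 1 \<notin> ?S"
  proof
    assume "replicate (Suc k) 1 \<in> ?S"
    then obtain u x where "replicate k 1 @ [1] = u @ [x]" "x \<in> {2..r}"
      by (auto simp flip: replicate_append_same)
    then show False by simp
  qed
  ultimately show ?thesis
    using finite_normal_words by (simp add: normal_words_Suc[OF assms] card_cartesian_product)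
qed

section \<open>Divisibility and joins on words\<close>

text \<open>\<open>word_le u v\<close> is the divisibility of the elements represented by \<open>u\<close> and \<open>v\<close>: a right factor
  without \<open>1\<close> prolongs the normal form of \<open>u\<close>, a right factor with \<open>1\<close> erases all of \<open>u\<close> but its length.\<close>

definition word_le :: "nat list \<Rightarrow> nat list \<Rightarrow> bool" where
  "word_le u v \<longleftrightarrow> prefix (nf u) (nf v) \<or> prefix (replicate (Suc (length u)) 1) (nf v)"

lemma prefix_replicate: "m \<le> n \<Longrightarrow> prefix (replicate m x) (replicate n x)"
  by (metis le_add_diff_inverse prefixI replicate_add)

text \<open>Suppose \<open>nf w\<close> lacks this block of ones. Then \<open>nf u\<close> is a
  prefix of it, and \<open>nf v\<close> is not, since two prefixes of one word are comparable. So
  \<open>nf w\<close> starts with more than \<open>length v\<close> ones, and these lie inside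
  \<open>nf u\<close>, making \<open>v\<close> divide \<open>u\<close>.\<close>

lemma word_le_incomparableD:
  assumes uw: "word_le u w" and vw: "word_le v w" and "\<not> word_le u v" "\<not> word_le v u"
  shows "prefix (replicate (Suc (length u)) 1) (nf w)"
proof (rule ccontr)
  assume n: "\<not> ?thesis"
  then have u: "prefix (nf u) (nf w)" using uw by (simp add: word_le_def)
  have "\<not> prefix (nf v) (nf w)"
    using prefix_same_cases[OF u] assms(3,4) by (auto simp: word_le_def)
  then have v: "prefix (replicate (Suc (length v)) 1) (nf w)"
    using vw by (simp add: word_le_def)
  \<comment> \<open>Otherwise the block of ones coming from \<open>v\<close> would contain the
    excluded block for \<open>u\<close>.\<close>
  have "length v < length u"
  proof (rule ccontr)
    assume "\<not> length v < length u"
    then have "prefix (replicate (Suc (length u)) (1::nat)) (replicate (Suc (length v)) 1)"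
      by (intro prefix_replicate) simp
    then show False using v n prefix_order.trans by blast
  qed
  then have "prefix (replicate (Suc (length v)) 1) (nf u)"
    using prefix_length_prefix[OF v u] by simp
  then show False using assms(4) by (simp add: word_le_def)
qed

text \<open>On words \<open>word_le\<close> is only a preorder; if it holds both ways, either word
  represents the join.\<close>

definition word_join :: "nat list \<Rightarrow> nat list \<Rightarrow> nat list" where
  "word_join u v =
     (if word_le u v then v else if word_le v u then u
      else replicate (Suc (max (length u) (length v))) 1)"

lemma word_le_replicate: "length u < n \<Longrightarrow> word_le u (replicate n 1)"
  unfolding word_le_def nf_replicate by (intro disjI2 prefix_replicate) simp

lemma word_le_join: "word_le u (word_join u v)" "word_le v (word_join u v)"
proof -
  have refl: "word_le w w" for w by (simp add: word_le_def)
  show "word_le u (word_join u v)" "word_le v (word_join u v)"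
    using word_le_replicate[of u "Suc (max (length u) (length v))"]
      word_le_replicate[of v "Suc (max (length u) (length v))"] refl
    unfolding word_join_def by simp_all
qed

lemma word_join_least:
  assumes "word_le u w" "word_le v w"
  shows "word_le (word_join u v) w"
proof -
  \<comment> \<open>Incomparability is symmetric, so \<open>nf w\<close> starts with both blocks of
    ones; the longer one is the join.\<close>
  have "prefix (replicate (Suc (max (length u) (length v))) 1) (nf w)"
    if "\<not> word_le u v" "\<not> word_le v u"
    using word_le_incomparableD[of u w v] word_le_incomparableD[of v w u] assms that
    by (simp add: max_def)
  then have "word_le (replicate (Suc (max (length u) (length v))) 1) w"
    if "\<not> word_le u v" "\<not> word_le v u"
    using that unfolding word_le_def[of "replicate _ _"] nf_replicate by blast
  then show ?thesis using assms unfolding word_join_def by (simp split del: if_split split: if_split)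
qed

section \<open>The presented monoid described by normal words\<close>

locale collapsing_monoid =
  fixes r :: nat
  assumes r: "r \<ge> 2"
begin

sublocale homogeneous_presentation "gens r" "rels r"
  by unfold_locales (auto simp: rels_def)

lemma one_in_gens: "1 \<in> gens r"
  using r by (simp add: gens_def)

sublocale graded_monoid M class_length
  using one_in_gens by (intro graded_monoid_presented) auto

text \<open>Once the tail is rewritten to start with \<open>1\<close>, the relation
  \<open>x 1 = 1 1\<close> turns the letter \<open>x\<close> in front of it into
  \<open>1\<close>.\<close>

lemma pres_cong_nf:
  assumes "u \<in> lists (gens r)"
  shows "(u, nf u) \<in> pres_cong (gens r) (rels r)"
  using assms
proof (induction u)
  case (Cons x u)
  then have x: "x \<in> gens r" and u: "u \<in> lists (gens r)" by auto
  show ?case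
  proof (cases "1 \<in> set u")
    case True
    then obtain w where w: "nf u = 1 # w" using nf_starts_with_one by blast
    have w': "w \<in> lists (gens r)" using nf_lists[OF u one_in_gens] w by auto
    have "([x] @ u, [x] @ 1 # w) \<in> pres_cong (gens r) (rels r)"
      using Cons.IH x w by (intro pres_cong.append pres_cong.refl) auto
    \<comment> \<open>For \<open>x = 1\<close> this is reflexivity, as \<open>rels\<close> starts at
      the generator 2.\<close>
    moreover have "([x, 1], [1, 1]) \<in> pres_cong (gens r) (rels r)"
    proof (cases "x = 1")
      case False
      then show ?thesis using x one_in_gens by (intro pres_cong.rel) (auto simp: gens_def rels_def)
    qed (use x in \<open>auto intro: pres_cong.refl\<close>)
    from pres_cong.append[OF this pres_cong.refl[OF w']]
    have "([x] @ 1 # w, 1 # 1 # w) \<in> pres_cong (gens r) (rels r)" by simp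
    ultimately show ?thesis using True w by (auto intro: pres_cong.trans)
  qed (use x u in \<open>auto intro!: pres_cong.refl\<close>)
qed (auto intro: pres_cong.refl)

text \<open>This solves the word problem: \<open>nf\<close> is constant on congruence classes and,
  by the preceding lemma, picks a member of each.\<close>

lemma pres_cong_iff_nf:
  assumes "u \<in> lists (gens r)" "v \<in> lists (gens r)"
  shows "(u, v) \<in> pres_cong (gens r) (rels r) \<longleftrightarrow> nf u = nf v"
proof
  assume "(u, v) \<in> pres_cong (gens r) (rels r)"
  then show "nf u = nf v"
  proof (induction rule: pres_cong.induct)
    case (append u v u' v')
    \<comment> \<open>By \<open>nf_append\<close>, the normal form of a product depends only on the
      two normal forms, the length of the left factor and the presence of \<open>1\<close> in the
      right one.\<close>
    have "1 \<in> set u' \<longleftrightarrow> 1 \<in> set v'" using append.IH(2) one_in_nf by metis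
    then show ?case
      using append.IH pres_cong_length[OF append.hyps(1)] by (auto simp: nf_append nf_id)
  qed (auto simp: rels_def)
next
  assume "nf u = nf v"
  then show "(u, v) \<in> pres_cong (gens r) (rels r)"
    using pres_cong_nf[OF assms(1)] pres_cong_nf[OF assms(2)]
    by (auto intro: pres_cong.sym pres_cong.trans)
qed

lemma cls_eq_iff_nf: "u \<in> lists (gens r) \<Longrightarrow> v \<in> lists (gens r) \<Longrightarrow> cls u = cls v \<longleftrightarrow> nf u = nf v"
  by (simp add: cls_eq_iff pres_cong_iff_nf)

lemma cls_divides_iff_word_le:
  assumes u: "u \<in> lists (gens r)" and v: "v \<in> lists (gens r)"
  shows "cls u divides\<^bsub>M\<^esub> cls v \<longleftrightarrow> word_le u v"
proof -
  have "cls u divides\<^bsub>M\<^esub> cls v \<longleftrightarrow> (\<exists>w\<in>lists (gens r). nf (u @ w) = nf v)"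
    unfolding cls_divides_iff[OF u v] using u v by (intro bex_cong refl pres_cong_iff_nf) auto
  also have "\<dots> \<longleftrightarrow> word_le u v"
  proof
    assume "\<exists>w\<in>lists (gens r). nf (u @ w) = nf v"
    then obtain w where w: "nf (u @ w) = nf v" by blast
    show "word_le u v"
    proof (cases "1 \<in> set w")
      case True
      \<comment> \<open>The normal form of a cofactor containing \<open>1\<close> starts with
        \<open>1\<close>; this accounts for the \<open>Suc\<close> in
        \<open>word_le\<close>.\<close>
      then obtain w' where "nf w = 1 # w'" using nf_starts_with_one by blast
      then have "nf v = replicate (Suc (length u)) 1 @ w'"
        using w True by (simp add: nf_append replicate_app_Cons_same)
      then show ?thesis by (simp add: word_le_def)
    next
      case False
      then show ?thesis using w[symmetric] by (simp add: word_le_def nf_append)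
    qed
  next
    have nfv: "nf v \<in> lists (gens r)" using nf_lists[OF v one_in_gens] .
    assume "word_le u v"
    then consider w where "nf v = nf u @ w" | w where "nf v = replicate (length u) 1 @ 1 # w"
      unfolding word_le_def prefix_def by (auto simp: replicate_app_Cons_same)
    then show "\<exists>w\<in>lists (gens r). nf (u @ w) = nf v"
    proof cases
      case 1
      have w: "w \<in> lists (gens r)" using nfv 1 by simp
      have "nf v = nf (nf u @ w)" using 1 by (metis nf_nf)
      also have "\<dots> = nf (u @ w)" by (simp add: nf_append)
      finally show ?thesis using w by (intro bexI[of _ w]) simp_all
    next
      case 2
      \<comment> \<open>Keeping the \<open>1\<close> after the first \<open>length u\<close> ones in
        the cofactor erases \<open>u\<close> as required.\<close>
      have w: "1 # w \<in> lists (gens r)" using nfv 2 by simp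
      have "nf v = nf (replicate (length u) 1 @ 1 # w)" using 2 by (metis nf_nf)
      also have "\<dots> = nf (u @ 1 # w)" by (simp add: nf_append)
      finally show ?thesis using w by (intro bexI[of _ "1 # w"]) simp_all
    qed
  qed
  finally show ?thesis .
qed

lemma left_cancellative_M: "left_cancellative M"
  unfolding left_cancellative_def carrier_M
proof (intro ballI impI; elim imageE)
  fix a b c u v w
  assume uvw: "a = cls u" "b = cls v" "c = cls w" "u \<in> lists (gens r)" "v \<in> lists (gens r)" "w \<in> lists (gens r)"
    and "a \<otimes>\<^bsub>M\<^esub> b = a \<otimes>\<^bsub>M\<^esub> c"
  then have "cls (u @ v) = cls (u @ w)"
    using cls_mult uvw(4-6) by metis
  moreover have "u @ v \<in> lists (gens r)" "u @ w \<in> lists (gens r)" using uvw by auto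
  ultimately have "nf (u @ v) = nf (u @ w)" using cls_eq_iff_nf by blast
  then have "nf v = nf w" by (rule nf_append_cancel)
  then show "b = c" using uvw(2,3,5,6) by (simp only: cls_eq_iff_nf)
qed

lemma word_join_lists: "u \<in> lists (gens r) \<Longrightarrow> v \<in> lists (gens r) \<Longrightarrow> word_join u v \<in> lists (gens r)"
  using one_in_gens by (simp add: word_join_def in_lists_conv_set set_replicate_conv_if)

lemma cls_word_join_lcm:
  assumes "u \<in> lists (gens r)" "v \<in> lists (gens r)"
  shows "cls (word_join u v) lcmof\<^bsub>M\<^esub> (cls u) (cls v)"
  unfolding islcm_def carrier_M
proof (intro conjI ballI impI)
  show "cls u divides\<^bsub>M\<^esub> cls (word_join u v)" "cls v divides\<^bsub>M\<^esub> cls (word_join u v)"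
    using assms word_join_lists[OF assms] word_le_join by (simp_all only: cls_divides_iff_word_le)
next
  fix c assume "c \<in> cls ` lists (gens r)" "cls u divides\<^bsub>M\<^esub> c \<and> cls v divides\<^bsub>M\<^esub> c"
  then show "cls (word_join u v) divides\<^bsub>M\<^esub> c"
    using assms word_join_lists[OF assms] word_join_least
    by (elim imageE) (simp only: cls_divides_iff_word_le)
qed

lemma lcm_exists:
  assumes "a \<in> carrier M" "b \<in> carrier M"
  shows "\<exists>c\<in>carrier M. c lcmof\<^bsub>M\<^esub> a b"
proof -
  obtain u v where "u \<in> lists (gens r)" "a = cls u" "v \<in> lists (gens r)" "b = cls v"
    using assms unfolding carrier_M by blast
  then show ?thesis
    using cls_word_join_lcm[of u v] cls_carrier[OF word_join_lists[of u v]] by blast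
qed

lemma upho_lattice_M: "upho_lattice (left_div_order M)"
  by (intro upho_lattice_left_div lcm_exists left_cancellative_M finite_class_length) (auto simp: gens_def)

text \<open>Every class contains exactly one normal word, so counting elements becomes counting
  normal words.\<close>

lemma card_class_length: "card {a \<in> carrier M. class_length a = k} = card (normal_words r k)"
proof -
  have "bij_betw cls (normal_words r k) {a \<in> carrier M. class_length a = k}"
  proof (rule bij_betw_imageI)
    show "inj_on cls (normal_words r k)"
      by (auto simp: inj_on_def normal_words_def cls_eq_iff_nf)
    have "cls u \<in> cls ` normal_words r (length u)" if "u \<in> lists (gens r)" for u
    proof (rule image_eqI)
      have "nf u \<in> lists (gens r)" using nf_lists[OF that one_in_gens] .
      then show "nf u \<in> normal_words r (length u)" "cls u = cls (nf u)"
        using that by (simp_all add: normal_words_def cls_eq_iff_nf)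
    qed
    then show "cls ` normal_words r k = {a \<in> carrier M. class_length a = k}"
      using class_length_cls by (fastforce simp: carrier_M normal_words_def)
  qed
  then show ?thesis by (rule bij_betw_same_card[symmetric])
qed

end

section \<open>The lattice \<open>M\<^sub>r\<close>\<close>

text \<open>Since \<open>rank\<close> is a choice, its values are read off by counting predecessors
  in the maximal chain through 0, an atom and the top.\<close>

lemma rank_M_lattice:
  assumes "r \<ge> 1"
  shows "rank (M_lattice r) 0 = 0" "rank (M_lattice r) (r + 1) = 2"
    and "i \<in> {1..r} \<Longrightarrow> rank (M_lattice r) i = 1"
proof -
  let ?L = "M_lattice r"
  obtain \<rho> where \<rho>: "rank_function ?L (enat 2) \<rho>"
    using finite_graded_M_lattice(1)[OF assms] unfolding finite_graded_lattice_def by blast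
  have rank: "rank ?L p = card {c \<in> {0, i, r + 1}. c \<sqsubset>\<^bsub>?L\<^esub> p}"
    if i: "i \<in> {1..r}" and p: "p \<in> {0, i, r + 1}" for i p
  proof (rule rank_eq_card[OF partial_order_M_lattice \<rho> _ p])
    show "pred_on.maxchain (carrier ?L) (\<sqsubset>\<^bsub>?L\<^esub>) {0, i, r + 1}"
      unfolding pred_on.maxchain_def
    proof (intro conjI notI)
      show "pred_on.chain (carrier ?L) (\<sqsubset>\<^bsub>?L\<^esub>) {0, i, r + 1}"
        using i unfolding pred_on.chain_def by auto
      \<comment> \<open>An extra element of a larger chain would be a second atom, incomparable with
        \<open>i\<close>.\<close>
      assume "\<exists>S. pred_on.chain (carrier ?L) (\<sqsubset>\<^bsub>?L\<^esub>) S \<and> {0, i, r + 1} \<subset> S"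
      then obtain S z where S: "pred_on.chain (carrier ?L) (\<sqsubset>\<^bsub>?L\<^esub>) S"
        and "i \<in> S" "z \<in> S" "z \<notin> {0, i, r + 1}" by blast
      then show False using i unfolding pred_on.chain_def by fastforce
    qed
  qed
  have eqs: "{c \<in> {0, i, r + 1}. c \<sqsubset>\<^bsub>?L\<^esub> 0} = {}"
    "{c \<in> {0, i, r + 1}. c \<sqsubset>\<^bsub>?L\<^esub> i} = {0}"
    "{c \<in> {0, i, r + 1}. c \<sqsubset>\<^bsub>?L\<^esub> r + 1} = {0, i}" if "i \<in> {1..r}" for i
    using that by auto
  show "rank ?L 0 = 0" "rank ?L (r + 1) = 2"
    using rank[of 1 0] rank[of 1 "r + 1"] eqs[of 1] assms by simp_all
  show "rank ?L i = 1" if "i \<in> {1..r}"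
    using rank[OF that, of i] eqs(2)[OF that] by simp
qed

text \<open>An atom has only the bottom below it; below the top the values sum to
  \<open>1 - r\<close>.\<close>

lemma mobius_M_lattice:
  assumes "r \<ge> 1"
  shows "mobius (M_lattice r) 0 0 = 1" and "i \<in> {1..r} \<Longrightarrow> mobius (M_lattice r) 0 i = - 1"
    and "mobius (M_lattice r) 0 (r + 1) = int r - 1"
proof -
  let ?L = "M_lattice r"
  show 0: "mobius ?L 0 0 = 1"
    by (subst mobius.simps) (simp add: partial_order_M_lattice at_least_at_most_def)
  show i: "mobius ?L 0 i = - 1" if "i \<in> {1..r}" for i
  proof -
    have "\<lbrace>0..i\<rbrace>\<^bsub>?L\<^esub> = {0, i}" "{0, i} - {i} = {0}" using that by (auto simp: at_least_at_most_def)
    then show ?thesis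
      using that 0 by (subst mobius.simps) (simp add: partial_order_M_lattice)
  qed
  have "\<lbrace>0..r + 1\<rbrace>\<^bsub>?L\<^esub> = {0..r + 1}" by (auto simp: at_least_at_most_def)
  moreover have "{0..r + 1} - {r + 1} = insert 0 {1..r}" by auto
  ultimately show "mobius ?L 0 (r + 1) = int r - 1"
    using 0 i by (subst mobius.simps) (simp add: partial_order_M_lattice)
qed

lemma char_poly_star_M_lattice:
  assumes "r \<ge> 1"
  shows "char_poly_star (M_lattice r) = [:1, - of_nat r, of_nat r - 1:]"
proof -
  let ?L = "M_lattice r"
  let ?t = "\<lambda>p. monom (of_int (mobius ?L 0 p)) (rank ?L p) :: rat poly"
  have "{0..r + 1} = insert 0 (insert (r + 1) {1..r})" by auto
  then have "char_poly_star ?L = ?t 0 + (?t (r + 1) + (\<Sum>p\<in>{1..r}. ?t p))"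
    unfolding char_poly_star_def by simp
  also have "(\<Sum>p\<in>{1..r}. ?t p) = (\<Sum>p\<in>{1..r}. monom (- 1) 1)"
    using mobius_M_lattice(2)[OF assms] rank_M_lattice(3)[OF assms] by (intro sum.cong) auto
  also have "\<dots> = monom (- of_nat r) 1"
    by (simp add: of_nat_poly monom_altdef)
  finally show ?thesis
    using mobius_M_lattice(1,3)[OF assms] rank_M_lattice(1,2)[OF assms]
    by (simp add: monom_altdef numeral_2_eq_2 algebra_simps)
qed

unbundle fps_syntax

section \<open>The core and the rank generating function\<close>

context collapsing_monoid
begin

lemma sup_atoms: "\<Squnion>\<^bsub>left_div_order M\<^esub> (atoms (left_div_order M)) = cls [1, 1]"
proof (rule partial_order.sup_eqI[OF partial_order_left_div])
  let ?L = "left_div_order M"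
  have gens: "1 \<in> gens r" "2 \<in> gens r" using r by (auto simp: gens_def)
  have w11: "[1, 1] \<in> lists (gens r)" using gens by simp
  have atom: "cls [x] \<in> atoms ?L" if "x \<in> gens r" for x
    using that by (simp add: atoms_left_div cls_carrier class_length_cls)
  have atomE: "\<exists>x\<in>gens r. s = cls [x]" if s: "s \<in> atoms ?L" for s
  proof -
    obtain u where u: "s = cls u" "u \<in> lists (gens r)"
      using s unfolding atoms_left_div carrier_M by blast
    then have "length u = 1" using s class_length_cls by (simp add: atoms_left_div)
    then obtain x where "u = [x]" by (auto simp: length_Suc_conv)
    then show ?thesis using u by auto
  qed
  show "least ?L (cls [1, 1]) (Upper ?L (atoms ?L))"
    unfolding least_def
  proof (intro conjI ballI)
    have "cls [x] divides\<^bsub>M\<^esub> cls [1, 1]" if "x \<in> gens r" for x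
      using word_le_replicate[of "[x]" 2] that w11
      by (subst cls_divides_iff_word_le) (simp_all add: numeral_2_eq_2)
    then show "cls [1, 1] \<in> Upper ?L (atoms ?L)"
      using atomE cls_carrier[OF w11] by (fastforce simp: Upper_def)
    fix b assume b: "b \<in> Upper ?L (atoms ?L)"
    then obtain w where w: "b = cls w" "w \<in> lists (gens r)"
      unfolding Upper_def left_div_order_simps carrier_M by blast
    have "word_le [x] w" if x: "x \<in> gens r" for x
    proof -
      have "cls [x] divides\<^bsub>M\<^esub> b"
        using b atom[OF x] cls_carrier[of "[x]"] x by (simp add: Upper_def)
      then show ?thesis using w x by (simp add: cls_divides_iff_word_le)
    qed
    \<comment> \<open>The two incomparable atoms \<open>[1]\<close> and \<open>[2]\<close>,
      available since \<open>r \<ge> 2\<close>, already force an upper bound to start with two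
      ones.\<close>
    then have "prefix (replicate (Suc (length [1::nat])) 1) (nf w)"
      using gens by (intro word_le_incomparableD[of "[1]" w "[2]"]) (auto simp: word_le_def)
    then have "word_le [1, 1] w" by (simp add: word_le_def)
    then show "cls [1, 1] \<sqsubseteq>\<^bsub>?L\<^esub> b" using w w11 by (simp add: cls_divides_iff_word_le)
  qed (auto simp: Upper_def)
qed

lemma order_isomorphic_core: "order_isomorphic (core (left_div_order M)) (M_lattice r)"
proof (rule order_isomorphic_sym)
  let ?L = "left_div_order M"
  define g where "g x = (if x = 0 then [] else if x = r + 1 then [1, 1] else [x])" for x
  have g: "g x \<in> lists (gens r)" if "x \<in> {0..r + 1}" for x
    using that r by (auto simp: g_def gens_def)
  have le: "cls (g x) divides\<^bsub>M\<^esub> cls (g y) \<longleftrightarrow> x = y \<or> x = 0 \<or> y = r + 1"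
    if "x \<in> {0..r + 1}" "y \<in> {0..r + 1}" for x y
    unfolding cls_divides_iff_word_le[OF g[OF that(1)] g[OF that(2)]]
    using that r by (auto simp: g_def word_le_def)
  \<comment> \<open>A divisor of \<open>[1, 1]\<close> has length at most two, and at length two its
    normal form is \<open>[1, 1]\<close>; so the core contains nothing beyond the image of
    \<open>g\<close>.\<close>
  have below: "\<exists>x\<in>{0..r + 1}. cls u = cls (g x)"
    if u: "u \<in> lists (gens r)" and div: "cls u divides\<^bsub>M\<^esub> cls [1, 1]" for u
  proof -
    have w11: "[1, 1] \<in> lists (gens r)" using one_in_gens by simp
    have pre: "prefix (nf u) [1, 1] \<or> prefix (replicate (Suc (length u)) 1) [1::nat, 1]"
      using div cls_divides_iff_word_le[OF u w11] unfolding word_le_def by simp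
    then have "length u \<le> 2" by (auto dest!: prefix_length_le)
    then consider "u = []" | x where "u = [x]" | "length u = 2"
      by (auto simp: le_Suc_eq numeral_2_eq_2 length_Suc_conv)
    then show ?thesis
    proof cases
      case 2
      then show ?thesis using u r by (intro bexI[of _ x]) (auto simp: g_def gens_def)
    next
      case 3
      then have "\<not> prefix (replicate (Suc (length u)) 1) [1::nat, 1]"
        by (auto dest!: prefix_length_le)
      then obtain zs where zs: "[1, 1] = nf u @ zs"
        using pre by (auto simp: prefix_def)
      have "length [1::nat, 1] = length u + length zs"
        unfolding zs length_append length_nf ..
      then have "nf u = [1, 1]" using zs 3 by simp
      then have "cls u = cls [1, 1]" using cls_eq_iff_nf[OF u w11] by simp
      then show ?thesis by (intro bexI[of _ "r + 1"]) (auto simp: g_def)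
    qed (auto simp: g_def intro!: bexI[of _ 0])
  qed
  have carrier: "carrier (core ?L) = (\<lambda>x. cls (g x)) ` {0..r + 1}"
  proof (intro equalityI subsetI)
    fix a assume "a \<in> carrier (core ?L)"
    then have "a \<in> carrier M" "a divides\<^bsub>M\<^esub> cls [1, 1]"
      by (simp_all add: core_def at_least_at_most_def sup_atoms[unfolded One_nat_def])
    then show "a \<in> (\<lambda>x. cls (g x)) ` {0..r + 1}"
      using below unfolding carrier_M by blast
  next
    fix a assume "a \<in> (\<lambda>x. cls (g x)) ` {0..r + 1}"
    then obtain x where x: "a = cls (g x)" "x \<in> {0..r + 1}" by blast
    have "g 0 = []" "g (r + 1) = [1, 1]" by (simp_all add: g_def)
    then show "a \<in> carrier (core ?L)"
      using le[of 0 x] le[of x "r + 1"] x cls_carrier[OF g[OF x(2)]]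
      unfolding core_def at_least_at_most_def sup_atoms bottom_left_div one_M by simp
  qed
  have po: "weak_partial_order ?L"
    using partial_order_left_div by (rule partial_order.axioms(1))
  have "weak_partial_order (core ?L)"
    unfolding core_def by (rule weak_partial_order_subset[OF po]) (auto simp: at_least_at_most_def)
  moreover have "weak_partial_order (M_lattice r)"
    using partial_order_M_lattice by (rule partial_order.axioms(1))
  moreover have "a \<sqsubseteq>\<^bsub>core ?L\<^esub> b \<longleftrightarrow> a divides\<^bsub>M\<^esub> b" for a b
    by (simp add: core_def)
  ultimately have "order_emb (M_lattice r) (core ?L) (\<lambda>x. cls (g x))"
    unfolding order_emb_def using le by simp
  moreover have "inj_on (\<lambda>x. cls (g x)) {0..r + 1}"
  proof (rule inj_onI)
    fix x y assume xy: "x \<in> {0..r + 1}" "y \<in> {0..r + 1}" "cls (g x) = cls (g y)"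
    \<comment> \<open>Equal classes divide each other, so antisymmetry of the order on
      \<open>M_lattice r\<close> applies through \<open>le\<close>.\<close>
    then show "x = y" using le[of x y] le[of y x] le[of x x] by auto
  qed
  ultimately show "order_isomorphic (M_lattice r) (core ?L)"
    unfolding order_isomorphic_def bij_betw_def carrier by auto
qed

lemma rank_gen_fun_nth: "rank_gen_fun (left_div_order M) $ k = of_nat (card (normal_words r k))"
proof -
  have "{p \<in> carrier M. rank (left_div_order M) p = k} = {p \<in> carrier M. class_length p = k}"
    by (auto simp: rank_left_div)
  then show ?thesis by (simp add: rank_gen_fun_def card_class_length)
qed

text \<open>The recursion for the counts says that multiplying by \<open>1 - (r - 1) x\<close>
  yields the geometric series, which \<open>1 - x\<close> inverts; the polynomial is the product of
  these two factors.\<close>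

lemma inverse_rank_gen_fun:
  "inverse (rank_gen_fun (left_div_order M)) = fps_of_poly [:1, - of_nat r, of_nat r - 1:]"
proof (rule fps_inverse_unique)
  let ?F = "rank_gen_fun (left_div_order M)" and ?c = "fps_const (of_nat r - 1) :: rat fps"
  let ?E = "Abs_fps (\<lambda>_. 1) :: rat fps"
  have F: "?F * (1 - ?c * fps_X) = ?E"
  proof (rule fps_ext)
    fix k
    have "?F * (1 - ?c * fps_X) = ?F - ?c * (?F * fps_X)"
      by (simp only: right_diff_distrib mult_1_right mult.left_commute)
    then have "(?F * (1 - ?c * fps_X)) $ k = ?F $ k - (of_nat r - 1) * (?F * fps_X) $ k"
      by (simp only: fps_sub_nth fps_mult_left_const_nth)
    also have "\<dots> = 1"
    \<comment> \<open>For \<open>k = Suc n\<close> the recursion leaves exactly 1, the contribution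
      of the all-ones word; for \<open>k = 0\<close> it is the empty word.\<close>
    proof (cases k)
      case (Suc n)
      then show ?thesis
        using r by (simp add: rank_gen_fun_nth card_normal_words_Suc of_nat_diff algebra_simps)
    qed (simp add: rank_gen_fun_nth normal_words_0)
    finally show "(?F * (1 - ?c * fps_X)) $ k = ?E $ k" by simp
  qed
  have E: "?E * (1 - fps_X) = 1"
    by (rule fps_ext) (simp add: algebra_simps)
  have "fps_of_poly [:1, - of_nat r, of_nat r - 1:] = (1 - ?c * fps_X) * (1 - fps_X)"
  proof -
    have "[:1, - of_nat r, of_nat r - 1:] = [:1, - (of_nat r - 1):] * [:1, - 1 :: rat:]"
      by simp
    then show ?thesis
      by (simp add: fps_of_poly_mult fps_of_poly_pCons algebra_simps)
  qed
  then show "?F * fps_of_poly [:1, - of_nat r, of_nat r - 1:] = 1"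
    by (simp only: F E flip: mult.assoc)
qed

end

theorem theorem4p2:
  fixes r :: nat and M :: "nat list set monoid" and L :: "nat list set gorder"
  assumes r: "r \<ge> 2"
    and M: "M = presented_monoid {1..r} {([i, 1], [1, 1]) | i. i \<in> {2..r}}"
    and L: "L = left_div_order M"
  shows "homogeneously_finitely_generated M \<and>
    left_cancellative M \<and>
    (\<forall>a\<in>carrier M. \<forall>b\<in>carrier M. \<exists>c\<in>carrier M. c lcmof\<^bsub>M\<^esub> a b) \<and>
    upho_lattice L \<and>
    order_isomorphic (core L) (M_lattice r) \<and>
    inverse (rank_gen_fun L) = fps_of_poly (char_poly_star (M_lattice r)) \<and>
    char_poly_star (M_lattice r) = [:1, - of_nat r, of_nat r - 1:]"
proof -
  interpret C: collapsing_monoid r by unfold_locales (rule r)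
  have M': "M = presented_monoid (gens r) (rels r)" unfolding M gens_def rels_def ..
  have "homogeneously_finitely_generated M"
    unfolding homogeneously_finitely_generated_def
  proof (intro conjI exI)
    \<comment> \<open>The generators are natural numbers already, so the given presentation is its
      own witness.\<close>
    show "M \<cong> presented_monoid (gens r) (rels r)" unfolding M' by (rule iso_refl)
  qed (use C.monoid_axioms M' in \<open>auto simp: gens_def rels_def\<close>)
  moreover have "char_poly_star (M_lattice r) = [:1, - of_nat r, of_nat r - 1:]"
    using r by (intro char_poly_star_M_lattice) simp
  ultimately show ?thesis
    using C.left_cancellative_M C.lcm_exists C.upho_lattice_M C.order_isomorphic_core
      C.inverse_rank_gen_fun
    unfolding L M' by simp
qed

end
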